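(* For every even integer $r\ge 4$ and every integer $t\ge 1$, the graphs $G_{r,t}$ and $H_{r,t}$ (defined in the context) are connected, nonisomorphic, have the same degree sequence, and each have $$n_{r,t}=rt+\frac{r(r+1)}{2}+C_r,\qquad C_r=\binom r2+\frac{r!}{2\,(r/2)!},$$ vertices. Moreover, $$b(G_{r,t},H_{r,t})\ \ge\ L_{r,t}=(r-1)t+\frac{r(r+1)}{2}-1,$$ and therefore, for every even $r\ge 4$, $$\liminf_{t\to\infty}\frac{b(G_{r,t},H_{r,t})}{n_{r,t}}\ \ge\ 1-\frac1r.$$
   Context: All graphs are finite and simple. For a graph $G$ and $v\in V(G)$, the graph $G-v$ (up to isomorphism) is a card of $G$; the vertex deck $\mathcal D(G)=\{G-v:v\in V(G)\}$ is a multiset. For graphs $G,H$ of the same order, $b(G,H)=|\mathcal D(G)\cap\mathcal D(H)|$ (multiset intersection); equivalently, the maximum $m$ such that there are $m$ distinct vertices $v_i$ of $G$ and $m$ distinct vertices $w_i$ of $H$ with $G-v_i\cong H-w_i$ for all $i\le m$. Two graphs have the same degree sequence if their multisets of vertex degrees agree. Let $r=2k\ge 4$ be even, $[r]=\{1,\dots,r\}$, and let $\operatorname{Even}(r)$ be the group of even permutations of $[r]$. A permutation $\sigma$ of $[r]$ acts on a graph $F$ with vertex set $[r]$ by letting $\sigma F$ be the graph on $[r]$ with edges $\sigma(i)\sigma(j)$ for $ij\in E(F)$. Seed graph $X_r$: write the label set as $[r]=A\cup D$ with $A=\{a_1,\dots,a_k\}$, $D=\{d_1,\dots,d_k\}$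 disjoint (a fixed labeling of $[r]$). $X_r$ is the graph on $[r]$ in which $A$ is a clique, $D$ is an independent set, and the only edges between $A$ and $D$ are $a_id_i$ for $i=1,\dots,k$. Let $\mathcal F_r=\{\sigma X_r:\sigma\in\operatorname{Even}(r)\}$, a set of labeled graphs on $[r]$. Selector $S_r$: its vertices are ports $p_1,\dots,p_r$, one pair vertex $q_{ij}$ for each unordered pair $\{i,j\}\subseteq[r]$ with $i\ne j$, and one selector vertex $z_F$ for each $F\in\mathcal F_r$. The edges are: $p_i$ is adjacent to every pair vertex whose index pair contains $i$; the vertices $z_F$ form a clique; and $z_F$ is adjacent to $q_{ij}$ exactly when $ij\in E(F)$. There are no other edges. Blow-up: for a vector $\mathbf a=(a_1,\dots,a_r)$ of integers with every $a_i\ge 2$, $S_r(\mathbf a)$ is the graph obtained from $S_r$ by replacing each port $p_i$ with an independent set $P_i$ of $a_i$ vertices, each having the same neighborhood as $p_i$ had in $S_r$ (namely all pair vertices whose index pair contains $i$). For $t\ge 1$ put $\mathbf a(t)=(t+1,t+2,t+3,\dots,t+r)$ and $\mathbf b(t)=(t+2,t+1,t+3,\dots,t+r)$ (the first two entries swapped), and set $G_{r,t}=S_r(\mathbf a(t))$, $H_{r,t}=S_r(\mathbf b(t))$. *)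

theory Defs
  imports
    "Graph_Theory.Graph_Theory"
    "HOL-Combinatorics.Permutations"
    "HOL-Library.Multiset"
    "HOL-Library.Extended_Real"
    "HOL-Library.Liminf_Limsup"
    Complex_Main
begin

text \<open>
  A finite simple graph is a \<open>pair_graph\<close>: an irreflexive symmetric arc relation on a finite vertex
  set, each edge being present as two opposite arcs. Hence the degree of a vertex is its
  \<open>out_degree\<close>, and \<open>digraph_iso\<close> is graph isomorphism.
\<close>

subsection \<open>Decks\<close>

definition iso_class :: "('a, 'b) pre_digraph \<Rightarrow> ('a, 'b) pre_digraph set" where
  "iso_class G = {K. digraph_iso G K}"

definition deck :: "('a, 'b) pre_digraph \<Rightarrow> ('a, 'b) pre_digraph set multiset" where
  "deck G = {# iso_class (pre_digraph.del_vert G v). v \<in># mset_set (verts G) #}"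

definition common_cards :: "('a, 'b) pre_digraph \<Rightarrow> ('a, 'b) pre_digraph \<Rightarrow> nat" where
  "common_cards G H = size (deck G \<inter># deck H)"

definition degree_multiset :: "('a, 'b) pre_digraph \<Rightarrow> nat multiset" where
  "degree_multiset G = {# out_degree G v. v \<in># mset_set (verts G) #}"

subsection \<open>The seed graph and its orbit under even permutations\<close>

text \<open>
  The labeling \<open>a, d\<close> stays a parameter: relabeling by an odd permutation can change
  the orbit \<open>seed_family\<close> below.
\<close>

definition seed_labeling :: "nat \<Rightarrow> (nat \<Rightarrow> nat) \<Rightarrow> (nat \<Rightarrow> nat) \<Rightarrow> bool" where
  "seed_labeling r a d \<longleftrightarrow>
     inj_on a {1..r div 2} \<and> inj_on d {1..r div 2} \<and>
     a ` {1..r div 2} \<inter> d ` {1..r div 2} = {} \<and>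
     a ` {1..r div 2} \<union> d ` {1..r div 2} = {1..r}"

definition seed_graph :: "nat \<Rightarrow> (nat \<Rightarrow> nat) \<Rightarrow> (nat \<Rightarrow> nat) \<Rightarrow> nat pair_pre_digraph" where
  "seed_graph r a d = \<lparr> pverts = {1..r},
     parcs = symcl ({(a i, a j) | i j. i \<in> {1..r div 2} \<and> j \<in> {1..r div 2} \<and> i \<noteq> j} \<union>
                    {(a i, d i) | i. i \<in> {1..r div 2}}) \<rparr>"

definition perm_graph :: "('a \<Rightarrow> 'a) \<Rightarrow> 'a pair_pre_digraph \<Rightarrow> 'a pair_pre_digraph" where
  "perm_graph \<sigma> F = \<lparr> pverts = \<sigma> ` pverts F, parcs = {(\<sigma> i, \<sigma> j) | i j. (i, j) \<in> parcs F} \<rparr>"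

definition seed_family :: "nat \<Rightarrow> (nat \<Rightarrow> nat) \<Rightarrow> (nat \<Rightarrow> nat) \<Rightarrow> nat pair_pre_digraph set" where
  "seed_family r a d = {perm_graph \<sigma> (seed_graph r a d) | \<sigma>. \<sigma> permutes {1..r} \<and> evenperm \<sigma>}"

subsection \<open>The selector and its blow-ups\<close>

datatype sel_vertex =
    Port nat
  | PairVertex "nat set"
  | SelVertex "nat pair_pre_digraph"

definition selector :: "nat \<Rightarrow> nat pair_pre_digraph set \<Rightarrow> sel_vertex pair_pre_digraph" where
  "selector r \<F> = \<lparr>
     pverts = Port ` {1..r} \<union> PairVertex ` {e. e \<subseteq> {1..r} \<and> card e = 2} \<union> SelVertex ` \<F>,
     parcs = symcl (
       {(Port i, PairVertex e) | i e. e \<subseteq> {1..r} \<and> card e = 2 \<and> i \<in> e} \<union>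
       {(SelVertex F, SelVertex F') | F F'. F \<in> \<F> \<and> F' \<in> \<F> \<and> F \<noteq> F'} \<union>
       {(SelVertex F, PairVertex {i, j}) | F i j. F \<in> \<F> \<and> (i, j) \<in> parcs F}) \<rparr>"

text \<open>Each vertex \<open>v\<close> is replaced by the independent set of its copies \<open>(v, 0), \<dots>, (v, m v - 1)\<close>.\<close>

definition blow_up :: "('v \<Rightarrow> nat) \<Rightarrow> 'v pair_pre_digraph \<Rightarrow> ('v \<times> nat) pair_pre_digraph" where
  "blow_up m S = \<lparr> pverts = {(v, c). v \<in> pverts S \<and> c < m v},
     parcs = {((u, c), (v, c')) | u c v c'. (u, v) \<in> parcs S \<and> c < m u \<and> c' < m v} \<rparr>"

fun port_mult :: "(nat \<Rightarrow> nat) \<Rightarrow> sel_vertex \<Rightarrow> nat" where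
  "port_mult s (Port i) = s i"
| "port_mult s _ = 1"

definition selector_blow_up ::
    "nat \<Rightarrow> (nat \<Rightarrow> nat) \<Rightarrow> (nat \<Rightarrow> nat) \<Rightarrow> (nat \<Rightarrow> nat) \<Rightarrow> (sel_vertex \<times> nat) pair_pre_digraph" where
  "selector_blow_up r a d s = blow_up (port_mult s) (selector r (seed_family r a d))"

definition a_vec :: "nat \<Rightarrow> nat \<Rightarrow> nat" where
  "a_vec t i = t + i"

definition b_vec :: "nat \<Rightarrow> nat \<Rightarrow> nat" where
  "b_vec t = (a_vec t)(1 := t + 2, 2 := t + 1)"

definition G_graph ::
    "(nat \<Rightarrow> nat) \<Rightarrow> (nat \<Rightarrow> nat) \<Rightarrow> nat \<Rightarrow> nat \<Rightarrow> (sel_vertex \<times> nat) pair_pre_digraph" where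
  "G_graph a d r t = selector_blow_up r a d (a_vec t)"

definition H_graph ::
    "(nat \<Rightarrow> nat) \<Rightarrow> (nat \<Rightarrow> nat) \<Rightarrow> nat \<Rightarrow> nat \<Rightarrow> (sel_vertex \<times> nat) pair_pre_digraph" where
  "H_graph a d r t = selector_blow_up r a d (b_vec t)"

definition C_const :: "nat \<Rightarrow> real" where
  "C_const r = real (r choose 2) + fact r / (2 * fact (r div 2))"

definition n_order :: "nat \<Rightarrow> nat \<Rightarrow> real" where
  "n_order r t = real r * real t + real r * (real r + 1) / 2 + C_const r"

definition L_bound :: "nat \<Rightarrow> nat \<Rightarrow> real" where
  "L_bound r t = (real r - 1) * real t + real r * (real r + 1) / 2 - 1"

subsection \<open>The constructions yield finite simple graphs\<close>

lemma symcl_iff: "(x, y) \<in> symcl R \<longleftrightarrow> (x, y) \<in> R \<or> (y, x) \<in> R"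
  by (auto simp: symcl_def)

lemma pair_graphI:
  assumes "finite (pverts G)"
    and "\<And>u v. (u, v) \<in> parcs G \<Longrightarrow> u \<in> pverts G \<and> u \<noteq> v \<and> (v, u) \<in> parcs G"
  shows "pair_graph G"
proof -
  have sub: "parcs G \<subseteq> pverts G \<times> pverts G"
    using assms(2) by (intro subrelI) blast
  have "finite (parcs G)"
    using sub assms(1) by (meson finite_SigmaI finite_subset)
  moreover have "sym (parcs G)"
    using assms(2) by (auto intro!: symI)
  ultimately show ?thesis
    using sub assms by unfold_locales (auto simp: symmetric_def)
qed

lemma pair_graph_seed_graph:
  assumes "seed_labeling r a d"
  shows "pair_graph (seed_graph r a d)"
proof (rule pair_graphI)
  show "finite (pverts (seed_graph r a d))"
    by (simp add: seed_graph_def)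
next
  fix u v assume "(u, v) \<in> parcs (seed_graph r a d)"
  then show "u \<in> pverts (seed_graph r a d) \<and> u \<noteq> v \<and> (v, u) \<in> parcs (seed_graph r a d)"
  proof -
    let ?K = "{1..r div 2}"
    define E where "E = {(a i, a j) | i j. i \<in> ?K \<and> j \<in> ?K \<and> i \<noteq> j} \<union> {(a i, d i) | i. i \<in> ?K}"
    have E: "x \<in> {1..r} \<and> y \<in> {1..r} \<and> x \<noteq> y" if xy: "(x, y) \<in> E" for x y
    proof -
      have inj: "inj_on a ?K" and disj: "a ` ?K \<inter> d ` ?K = {}"
        and un: "a ` ?K \<union> d ` ?K = {1..r}"
        using assms unfolding seed_labeling_def by blast+
      consider i j where "x = a i" "y = a j" "i \<in> ?K" "j \<in> ?K" "i \<noteq> j"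
        | i where "x = a i" "y = d i" "i \<in> ?K"
        using xy unfolding E_def by blast
      then show ?thesis
      proof cases
        case 1
        then show ?thesis using inj un[symmetric] by (metis UnI1 imageI inj_onD)
      next
        case 2
        then have "x \<in> a ` ?K" "y \<in> d ` ?K" by blast+
        then show ?thesis using disj un[symmetric] by blast
      qed
    qed
    have G: "seed_graph r a d = \<lparr> pverts = {1..r}, parcs = symcl E \<rparr>"
      by (simp only: seed_graph_def E_def)
    show ?thesis
      using E \<open>(u, v) \<in> parcs (seed_graph r a d)\<close>
      unfolding G pair_pre_digraph.simps symcl_iff by blast
  qed
qed

lemma pair_graph_perm_graph:
  assumes "pair_graph F" and "inj \<sigma>"
  shows "pair_graph (perm_graph \<sigma> F)"
proof -
  interpret pair_graph F by fact
  show ?thesis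
  proof (rule pair_graphI)
    show "finite (pverts (perm_graph \<sigma> F))"
      by (simp add: perm_graph_def)
  next
    fix u v assume "(u, v) \<in> parcs (perm_graph \<sigma> F)"
    then show "u \<in> pverts (perm_graph \<sigma> F) \<and> u \<noteq> v \<and> (v, u) \<in> parcs (perm_graph \<sigma> F)"
    proof -
      obtain i j where uv: "u = \<sigma> i" "v = \<sigma> j" "(i, j) \<in> parcs F"
        using \<open>(u, v) \<in> parcs (perm_graph \<sigma> F)\<close> unfolding perm_graph_def by auto
      have "u \<noteq> v"
        using uv no_loops' injD[OF assms(2)] by metis
      moreover have "u \<in> pverts (perm_graph \<sigma> F)"
        using uv in_arcsD1 by (simp add: perm_graph_def)
      moreover have "(v, u) \<in> parcs (perm_graph \<sigma> F)"
        using uv arcs_symmetric unfolding perm_graph_def pair_pre_digraph.simps by blast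
      ultimately show ?thesis by blast
    qed
  qed
qed

lemma finite_seed_family: "finite (seed_family r a d)"
proof -
  have "seed_family r a d \<subseteq> (\<lambda>\<sigma>. perm_graph \<sigma> (seed_graph r a d)) ` {\<sigma>. \<sigma> permutes {1..r}}"
    by (auto simp: seed_family_def)
  then show ?thesis
    by (rule finite_subset) (simp add: finite_permutations)
qed

lemma seed_family_graph:
  assumes "seed_labeling r a d" and "F \<in> seed_family r a d"
  shows "pair_graph F" and "pverts F = {1..r}"
proof -
  obtain \<sigma> where \<sigma>: "\<sigma> permutes {1..r}" and F: "F = perm_graph \<sigma> (seed_graph r a d)"
    using assms(2) by (auto simp: seed_family_def)
  show "pair_graph F"
    unfolding F using assms(1) \<sigma> by (intro pair_graph_perm_graph pair_graph_seed_graph permutes_inj)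
  show "pverts F = {1..r}"
    unfolding F using permutes_image[OF \<sigma>] by (simp add: perm_graph_def seed_graph_def)
qed

lemma pair_graph_selector:
  assumes fin: "finite \<F>" and F: "\<And>F. F \<in> \<F> \<Longrightarrow> pair_graph F \<and> pverts F = {1..r}"
  shows "pair_graph (selector r \<F>)"
proof (rule pair_graphI)
  have "finite {e. e \<subseteq> {1..r} \<and> card e = 2}"
    by (rule finite_subset[of _ "Pow {1..r}"]) auto
  then show "finite (pverts (selector r \<F>))"
    using fin by (simp add: selector_def)
next
  fix u v assume uv: "(u, v) \<in> parcs (selector r \<F>)"
  let ?P = "{e. e \<subseteq> {1..r} \<and> card e = 2}"
  define V where "V = Port ` {1..r} \<union> PairVertex ` ?P \<union> SelVertex ` \<F>"
  define E where "E =
       {(Port i, PairVertex e) | i e. e \<subseteq> {1..r} \<and> card e = 2 \<and> i \<in> e} \<union>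
       {(SelVertex F, SelVertex F') | F F'. F \<in> \<F> \<and> F' \<in> \<F> \<and> F \<noteq> F'} \<union>
       {(SelVertex F, PairVertex {i, j}) | F i j. F \<in> \<F> \<and> (i, j) \<in> parcs F}"
  have G: "selector r \<F> = \<lparr> pverts = V, parcs = symcl E \<rparr>"
    by (simp only: selector_def V_def E_def)
  have arc: "{i, j} \<in> ?P" if "F \<in> \<F>" "(i, j) \<in> parcs F" for F i j
  proof -
    interpret pair_graph F using F that by blast
    have "i \<in> {1..r}" "j \<in> {1..r}" "i \<noteq> j"
      using in_arcsD1[OF that(2)] in_arcsD2[OF that(2)] no_loops'[OF that(2)] F[OF that(1)] by simp_all
    then show ?thesis by simp
  qed
  have "x \<in> V \<and> y \<in> V \<and> x \<noteq> y" if xy: "(x, y) \<in> E" for x y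
  proof -
    consider i e where "x = Port i" "y = PairVertex e" "e \<in> ?P" "i \<in> e"
      | F F' where "x = SelVertex F" "y = SelVertex F'" "F \<in> \<F>" "F' \<in> \<F>" "F \<noteq> F'"
      | F i j where "x = SelVertex F" "y = PairVertex {i, j}" "F \<in> \<F>" "(i, j) \<in> parcs F"
      using xy unfolding E_def by blast
    then show ?thesis
    proof cases
      case 1
      then have "i \<in> {1..r}" by blast
      with 1 show ?thesis by (simp add: V_def)
    next
      case 2
      then show ?thesis by (simp add: V_def)
    next
      case 3
      have "y \<in> V" using arc[OF 3(3,4)] 3(2) unfolding V_def by blast
      with 3 show ?thesis by (simp add: V_def)
    qed
  qed
  then show "u \<in> pverts (selector r \<F>) \<and> u \<noteq> v \<and> (v, u) \<in> parcs (selector r \<F>)"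
    using uv unfolding G pair_pre_digraph.simps symcl_iff by blast
qed

lemma pair_graph_blow_up:
  assumes "pair_graph S"
  shows "pair_graph (blow_up m S)"
proof -
  interpret pair_graph S by fact
  show ?thesis
  proof (rule pair_graphI)
    have "pverts (blow_up m S) = Sigma (pverts S) (\<lambda>v. {..<m v})"
      by (auto simp: blow_up_def)
    then show "finite (pverts (blow_up m S))"
      by simp
  next
    fix u v assume "(u, v) \<in> parcs (blow_up m S)"
    then show "u \<in> pverts (blow_up m S) \<and> u \<noteq> v \<and> (v, u) \<in> parcs (blow_up m S)"
    proof -
      obtain x c y c' where uv: "u = (x, c)" "v = (y, c')" "(x, y) \<in> parcs S" "c < m x" "c' < m y"
        using \<open>(u, v) \<in> parcs (blow_up m S)\<close> unfolding blow_up_def by auto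
      have "x \<noteq> y" "x \<in> pverts S" "(y, x) \<in> parcs S"
        using uv(3) no_loops' in_arcsD1 arcs_symmetric by metis+
      then show ?thesis
        using uv by (simp add: blow_up_def)
    qed
  qed
qed

lemma pair_graph_selector_blow_up:
  assumes "seed_labeling r a d"
  shows "pair_graph (selector_blow_up r a d s)"
  unfolding selector_blow_up_def
  using assms seed_family_graph finite_seed_family
  by (intro pair_graph_blow_up pair_graph_selector) auto

lemma wf_digraph_del_vert_pair_graph:
  assumes "pair_graph G"
  shows "wf_digraph (pre_digraph.del_vert (with_proj G) v)"
proof -
  interpret pair_graph G by fact
  show ?thesis by (rule wf_digraph_del_vert)
qed

lemma digraph_iso_refl: "wf_digraph G \<Longrightarrow> digraph_iso G G"
  unfolding digraph_iso_def
  by (rule exI[of _ "\<lparr>iso_verts = id, iso_arcs = id, iso_head = head G, iso_tail = tail G\<rparr>"])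
     (simp add: app_iso_def pre_digraph.digraph_isomorphism_def)

lemma iso_class_eq_iff:
  assumes "wf_digraph G" and "wf_digraph H"
  shows "iso_class G = iso_class H \<longleftrightarrow> digraph_iso G H"
proof
  assume "iso_class G = iso_class H"
  moreover have "H \<in> iso_class H"
    using digraph_iso_refl[OF assms(2)] by (simp add: iso_class_def)
  ultimately show "digraph_iso G H"
    unfolding iso_class_def by blast
next
  assume GH: "digraph_iso G H"
  then have HG: "digraph_iso H G"
    by (rule digraph_iso_swap[OF assms(1)])
  show "iso_class G = iso_class H"
    unfolding iso_class_def
    by (intro Collect_cong iffI) (erule digraph_iso_trans[OF HG], erule digraph_iso_trans[OF GH])
qed

end

(* Every automorphism of the seed graph permutes the clique and the pendant vertices in parallel, hence
   is an even permutation; so the orbit under even permutations has r! / (2 (r/2)!) members, and only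
   even permutations preserve it. Since ports are exactly the vertices with a false twin, an isomorphism
   between two blow-ups amounts to an even permutation of [r] matching the multiplicities. The only
   permutation matching a(t) with b(t) is the odd transposition (1 2), so the graphs are not isomorphic.
   Deleting a copy of port i >= 2 makes ports i - 1 and i equally large; the transposition (i-1 i) then
   corrects the parity, and the card occurs in both decks. *)
theory Submission
  imports Defs
begin

section \<open>The seed graph and its orbit\<close>

text \<open>With the orbit under all permutations, every permutation of the ports would extend to
  the selector and the two blow-ups would be isomorphic. Restricting to even permutations makes
  parity the only obstruction. Degrees cannot detect it: the degree of a pair vertex records two
  multiplicities and the number of family members containing that pair, and even permutations
  already carry any pair to any other. The bound \<open>L_bound\<close> counts the copies of ports 2
  to r. The t + 1 copies of port 1 are left out because deleting one of them leaves pairwise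
  different multiplicities, so no spare transposition is available to correct the parity. These
  copies make up asymptotically a fraction 1/r of the order, while the \<open>C_const r\<close> pair
  and selector vertices do not grow with t; hence the limit 1 - 1/r. The clique on the selector
  vertices serves recognition: adjacent vertices are never false twins.\<close>

definition seed_stabilizer :: "nat \<Rightarrow> (nat \<Rightarrow> nat) \<Rightarrow> (nat \<Rightarrow> nat) \<Rightarrow> (nat \<Rightarrow> nat) set" where
  "seed_stabilizer r a d = {\<alpha>. \<alpha> permutes {1..r} \<and> perm_graph \<alpha> (seed_graph r a d) = seed_graph r a d}"

lemma perm_graph_id [simp]: "perm_graph id F = F"
  by (cases F) (auto simp: perm_graph_def)

lemma perm_graph_comp: "perm_graph (\<sigma> \<circ> \<rho>) F = perm_graph \<sigma> (perm_graph \<rho> F)"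
  by (cases F) (auto simp: perm_graph_def image_comp)

lemma perm_graph_arc_iff:
  assumes "inj \<sigma>"
  shows "(\<sigma> i, \<sigma> j) \<in> parcs (perm_graph \<sigma> F) \<longleftrightarrow> (i, j) \<in> parcs F"
  using assms by (auto simp: perm_graph_def dest: injD)

lemma perm_graph_arc_iff_inv:
  assumes "bij \<sigma>"
  shows "(i, j) \<in> parcs (perm_graph \<sigma> F) \<longleftrightarrow> (inv \<sigma> i, inv \<sigma> j) \<in> parcs F"
  using perm_graph_arc_iff[of \<sigma> "inv \<sigma> i" "inv \<sigma> j" F] assms
  by (simp add: bij_is_inj bij_is_surj surj_f_inv_f)

lemma perm_graph_inj:
  assumes "bij \<sigma>" "perm_graph \<sigma> F = perm_graph \<sigma> F'"
  shows "F = F'"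
proof -
  have "perm_graph (inv \<sigma> \<circ> \<sigma>) F = perm_graph (inv \<sigma> \<circ> \<sigma>) F'"
    using assms(2) by (simp only: perm_graph_comp)
  then show ?thesis using assms(1) by (simp add: bij_is_inj)
qed

(* Otherwise the simplifier turns the intervals {1..r} into {Suc 0..r}. *)
declare One_nat_def [simp del]

locale seed =
  fixes r :: nat and a d :: "nat \<Rightarrow> nat"
  assumes r_ge_4: "r \<ge> 4" and labeling: "seed_labeling r a d"
begin

abbreviation "K \<equiv> {1..r div 2}"
abbreviation "X \<equiv> seed_graph r a d"

lemma
  shows inj_a: "inj_on a K" and inj_d: "inj_on d K"
    and disj: "a ` K \<inter> d ` K = {}" and cover: "a ` K \<union> d ` K = {1..r}"
  using labeling unfolding seed_labeling_def by auto

lemma ad_neq: "i \<in> K \<Longrightarrow> j \<in> K \<Longrightarrow> a i \<noteq> d j"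
  using disj by blast

lemma label_cases:
  assumes "x \<in> {1..r}"
  obtains i where "i \<in> K" "x = a i" | i where "i \<in> K" "x = d i"
  using assms cover by blast

lemma label_mem: "i \<in> K \<Longrightarrow> a i \<in> {1..r}" "i \<in> K \<Longrightarrow> d i \<in> {1..r}"
  using cover by blast+

lemma seed_arc:
  assumes "i \<in> K" "j \<in> K"
  shows "(a i, a j) \<in> parcs X \<longleftrightarrow> i \<noteq> j" "(a i, d j) \<in> parcs X \<longleftrightarrow> i = j"
    "(d i, a j) \<in> parcs X \<longleftrightarrow> i = j" "(d i, d j) \<notin> parcs X"
proof -
  have arc: "(x, y) \<in> parcs X \<longleftrightarrow>
     (\<exists>i j. i \<in> K \<and> j \<in> K \<and> i \<noteq> j \<and> x = a i \<and> y = a j) \<or>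
     (\<exists>i. i \<in> K \<and> x = a i \<and> y = d i) \<or> (\<exists>i. i \<in> K \<and> x = d i \<and> y = a i)" for x y
    unfolding seed_graph_def pair_pre_digraph.simps symcl_iff by blast
  show "(a i, a j) \<in> parcs X \<longleftrightarrow> i \<noteq> j" "(a i, d j) \<in> parcs X \<longleftrightarrow> i = j"
    "(d i, a j) \<in> parcs X \<longleftrightarrow> i = j" "(d i, d j) \<notin> parcs X"
    unfolding arc using assms ad_neq inj_a inj_d by (metis inj_onD)+
qed

lemma seed_arc_verts:
  assumes "(x, y) \<in> parcs X"
  shows "x \<in> {1..r} \<and> y \<in> {1..r}"
proof -
  interpret pair_graph X by (rule pair_graph_seed_graph[OF labeling])
  have "pverts X = {1..r}" by (simp only: seed_graph_def pair_pre_digraph.simps)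
  then show ?thesis
    using in_arcsD1[OF assms] in_arcsD2[OF assms] by (simp only:)
qed

text \<open>A pendant vertex sees only its partner, while a clique vertex sees its partner and, as
  there are at least two indices, another clique vertex. The right-hand side speaks of adjacency
  alone, so automorphisms preserve the clique.\<close>

lemma clique_iff:
  "x \<in> a ` K \<longleftrightarrow> (\<exists>y z. y \<noteq> z \<and> (x, y) \<in> parcs X \<and> (x, z) \<in> parcs X)"
proof
  assume "x \<in> a ` K"
  then obtain i where i: "i \<in> K" "x = a i" by blast
  define j where "j = (if i = 1 then 2 else 1 :: nat)"
  have j: "j \<in> K" "i \<noteq> j" using i r_ge_4 by (auto simp: j_def)
  have "(x, a j) \<in> parcs X" "(x, d i) \<in> parcs X" "a j \<noteq> d i"
    using i j seed_arc ad_neq by auto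
  then show "\<exists>y z. y \<noteq> z \<and> (x, y) \<in> parcs X \<and> (x, z) \<in> parcs X" by blast
next
  assume "\<exists>y z. y \<noteq> z \<and> (x, y) \<in> parcs X \<and> (x, z) \<in> parcs X"
  then obtain y z where yz: "y \<noteq> z" "(x, y) \<in> parcs X" "(x, z) \<in> parcs X" by blast
  have only: "w = a i" if "i \<in> K" "x = d i" "(x, w) \<in> parcs X" for i w
  proof -
    have "w \<in> {1..r}" using that seed_arc_verts by blast
    then show ?thesis
    proof (cases rule: label_cases)
      case (1 j)
      then show ?thesis using that seed_arc(3)[of i j] by simp
    next
      case (2 j)
      then show ?thesis using that seed_arc(4)[of i j] by simp
    qed
  qed
  have "x \<in> {1..r}" using yz seed_arc_verts by blast
  then show "x \<in> a ` K"
    by (cases rule: label_cases) (use only yz in \<open>blast\<close>, use only yz in \<open>metis\<close>)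
qed

text \<open>The automorphisms of the seed graph are exactly the following permutations.\<close>

definition index_perm :: "(nat \<Rightarrow> nat) \<Rightarrow> nat \<Rightarrow> nat" where
  "index_perm \<pi> = map_permutation K a \<pi> \<circ> map_permutation K d \<pi>"

lemma index_perm_apply:
  assumes "\<pi> permutes K" "i \<in> K"
  shows "index_perm \<pi> (a i) = a (\<pi> i)" "index_perm \<pi> (d i) = d (\<pi> i)"
proof -
  have "a i \<notin> d ` K" "d (\<pi> i) \<notin> a ` K"
    using assms disj permutes_in_image[OF assms(1)] by blast+
  then have "map_permutation K d \<pi> (a i) = a i" "map_permutation K a \<pi> (d (\<pi> i)) = d (\<pi> i)"
    by (simp_all add: map_permutation_def)
  then show "index_perm \<pi> (a i) = a (\<pi> i)" "index_perm \<pi> (d i) = d (\<pi> i)"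
    using assms by (simp_all add: index_perm_def map_permutation_apply inj_a inj_d)
qed

lemma
  assumes "\<pi> permutes K"
  shows index_perm_permutes: "index_perm \<pi> permutes {1..r}"
    and evenperm_index_perm: "evenperm (index_perm \<pi>)"
proof -
  let ?A = "map_permutation K a \<pi>" and ?D = "map_permutation K d \<pi>"
  have A: "?A permutes a ` K" and D: "?D permutes d ` K"
    using assms inj_a inj_d by (auto intro!: map_permutation_permutes simp: bij_betw_def)
  show "index_perm \<pi> permutes {1..r}"
    unfolding index_perm_def
    by (intro permutes_compose permutes_subset[OF A] permutes_subset[OF D]) (use cover in blast)+
  have "permutation ?A" "permutation ?D"
    using A D by (auto intro: permutes_imp_permutation[rotated])
  then show "evenperm (index_perm \<pi>)"
    unfolding index_perm_def
    by (simp add: evenperm_comp evenperm_map_permutation[OF inj_a assms] evenperm_map_permutation[OF inj_d assms])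
qed

lemma index_perm_stabilizes:
  assumes "\<pi> permutes K"
  shows "index_perm \<pi> \<in> seed_stabilizer r a d"
proof -
  let ?\<alpha> = "index_perm \<pi>"
  have perm: "?\<alpha> permutes {1..r}" by (rule index_perm_permutes[OF assms])
  have pK: "\<pi> i \<in> K \<longleftrightarrow> i \<in> K" for i using permutes_in_image[OF assms] .
  have eq: "\<pi> i = \<pi> j \<longleftrightarrow> i = j" for i j
    using permutes_inj[OF assms] by (auto dest: injD)
  have iff: "(?\<alpha> x, ?\<alpha> y) \<in> parcs X \<longleftrightarrow> (x, y) \<in> parcs X" for x y
  proof (cases "x \<in> {1..r} \<and> y \<in> {1..r}")
    case False
    then have "\<not> (?\<alpha> x \<in> {1..r} \<and> ?\<alpha> y \<in> {1..r})"
      using permutes_in_image[OF perm] by simp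
    with False show ?thesis using seed_arc_verts by blast
  next
    case True
    then have "x \<in> {1..r}" "y \<in> {1..r}" by auto
    then show ?thesis
      by (elim label_cases) (simp_all add: index_perm_apply[OF assms] seed_arc pK eq del: atLeastAtMost_iff)
  qed
  have "perm_graph ?\<alpha> X = X"
  proof (rule pair_pre_digraph.equality)
    show "pverts (perm_graph ?\<alpha> X) = pverts X"
      using permutes_image[OF perm] by (simp add: perm_graph_def seed_graph_def)
    have "(x, y) \<in> parcs (perm_graph ?\<alpha> X) \<longleftrightarrow> (x, y) \<in> parcs X" for x y
      using iff[of "inv ?\<alpha> x" "inv ?\<alpha> y"]
      by (simp add: perm_graph_arc_iff_inv permutes_bij[OF perm] permutes_inverses[OF perm])
    then show "parcs (perm_graph ?\<alpha> X) = parcs X" by auto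
  qed simp
  with perm show ?thesis by (simp add: seed_stabilizer_def)
qed

text \<open>An automorphism preserves the clique and so permutes the indices of its vertices; each
  pendant vertex must then follow its unique neighbour.\<close>

lemma stabilizer_index_perm:
  assumes "\<alpha> \<in> seed_stabilizer r a d"
  obtains \<pi> where "\<pi> permutes K" "\<alpha> = index_perm \<pi>"
proof -
  have perm: "\<alpha> permutes {1..r}" and stab: "perm_graph \<alpha> X = X"
    using assms by (auto simp: seed_stabilizer_def)
  have inj: "inj \<alpha>" by (rule permutes_inj[OF perm])
  have iff: "(\<alpha> x, \<alpha> y) \<in> parcs X \<longleftrightarrow> (x, y) \<in> parcs X" for x y
    using perm_graph_arc_iff[OF inj, of x y X] by (simp add: stab)
  have clique: "\<alpha> x \<in> a ` K \<longleftrightarrow> x \<in> a ` K" for x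
  proof -
    have surj: "\<exists>y. w = \<alpha> y" for w using permutes_surj[OF perm] by blast
    show ?thesis
      unfolding clique_iff using iff surj inj by (metis injD)
  qed
  \<comment> \<open>The identity off \<open>K\<close>, as \<open>permutes\<close> demands.\<close>
  define \<pi> where "\<pi> i = (if i \<in> K then inv_into K a (\<alpha> (a i)) else i)" for i
  have \<pi>K: "\<pi> i \<in> K" and \<alpha>a: "\<alpha> (a i) = a (\<pi> i)" if "i \<in> K" for i
  proof -
    have "\<alpha> (a i) \<in> a ` K" using clique that by blast
    then show "\<pi> i \<in> K" "\<alpha> (a i) = a (\<pi> i)"
      using that by (simp_all only: \<pi>_def if_True inv_into_into f_inv_into_f)
  qed
  have "inj_on \<pi> K"
    using \<alpha>a inj inj_a by (metis inj_onI inj_onD injD)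
  then have "bij_betw \<pi> K K"
    using \<pi>K by (simp add: bij_betw_def card_subset_eq endo_inj_surj image_subset_iff)
  then have \<pi>: "\<pi> permutes K"
    by (rule bij_imp_permutes) (auto simp: \<pi>_def)
  have \<alpha>d: "\<alpha> (d i) = d (\<pi> i)" if i: "i \<in> K" for i
  proof -
    have "d i \<notin> a ` K" using disj i by blast
    then have "\<alpha> (d i) \<notin> a ` K" "\<alpha> (d i) \<in> {1..r}"
      using clique label_mem(2)[OF i] permutes_in_image[OF perm] by blast+
    then obtain j where j: "j \<in> K" "\<alpha> (d i) = d j"
      using cover by blast
    \<comment> \<open>The image of the edge between \<open>a i\<close> and \<open>d i\<close>; a
      clique vertex has just one pendant neighbour, which forces \<open>j\<close>.\<close>
    have "(a (\<pi> i), d j) \<in> parcs X"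
      using iff[of "a i" "d i"] seed_arc(2)[OF i i] j \<alpha>a[OF i] by simp
    then show ?thesis using seed_arc(2)[OF \<pi>K[OF i] j(1)] j by simp
  qed
  have "\<alpha> x = index_perm \<pi> x" for x
  proof (cases "x \<in> {1..r}")
    case True
    then show ?thesis
      by (elim label_cases) (simp_all only: index_perm_apply[OF \<pi>] \<alpha>a \<alpha>d)
  next
    case False
    then show ?thesis
      using permutes_not_in perm index_perm_permutes[OF \<pi>] by metis
  qed
  then show thesis using \<pi> that by blast
qed

lemma evenperm_stabilizer: "\<alpha> \<in> seed_stabilizer r a d \<Longrightarrow> evenperm \<alpha>"
  by (erule stabilizer_index_perm) (simp add: evenperm_index_perm)

lemma card_stabilizer: "card (seed_stabilizer r a d) = fact (r div 2)"
proof -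
  have "seed_stabilizer r a d = index_perm ` {\<pi>. \<pi> permutes K}"
    using stabilizer_index_perm index_perm_stabilizes by blast
  moreover have "inj_on index_perm {\<pi>. \<pi> permutes K}"
  proof (intro inj_onI ext)
    fix \<pi> \<rho> i assume "\<pi> \<in> {\<pi>. \<pi> permutes K}" "\<rho> \<in> {\<pi>. \<pi> permutes K}"
      and eq: "index_perm \<pi> = index_perm \<rho>"
    then have perm: "\<pi> permutes K" "\<rho> permutes K" by auto
    show "\<pi> i = \<rho> i"
    proof (cases "i \<in> K")
      case True
      then have "a (\<pi> i) = a (\<rho> i)"
        using index_perm_apply(1) perm eq by metis
      then show ?thesis
        using True permutes_in_image[OF perm(1)] permutes_in_image[OF perm(2)] inj_a by (metis inj_onD)
    next
      case False
      then show ?thesis using perm by (metis permutes_not_in)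
    qed
  qed
  ultimately show ?thesis
    by (simp add: card_image card_permutations)
qed

text \<open>A coincidence would make \<open>inv \<sigma> \<circ> \<rho>\<close> an odd automorphism
  of the seed. Hence odd relabellings of the seed all leave the family.\<close>

lemma odd_image_neq:
  assumes "\<sigma> permutes {1..r}" "evenperm \<sigma>" "\<rho> permutes {1..r}" "\<not> evenperm \<rho>"
  shows "perm_graph \<rho> X \<noteq> perm_graph \<sigma> X"
proof
  assume eq: "perm_graph \<rho> X = perm_graph \<sigma> X"
  have "perm_graph (inv \<sigma> \<circ> \<rho>) X = perm_graph (inv \<sigma> \<circ> \<sigma>) X"
    by (simp only: perm_graph_comp eq)
  also have "\<dots> = X"
    by (simp add: permutes_inv_o[OF assms(1)])
  finally have "inv \<sigma> \<circ> \<rho> \<in> seed_stabilizer r a d"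
    using permutes_compose[OF assms(3) permutes_inv[OF assms(1)]] by (simp add: seed_stabilizer_def)
  then have "evenperm (inv \<sigma> \<circ> \<rho>)" by (rule evenperm_stabilizer)
  moreover have "permutation \<sigma>" "permutation \<rho>"
    using assms by (auto intro: permutes_imp_permutation[rotated])
  ultimately show False
    using assms by (simp add: evenperm_comp evenperm_inv permutation_inverse)
qed

end

section \<open>Counting the orbit of the seed\<close>

lemma card_even_permutations:
  assumes "finite S" "x \<in> S" "y \<in> S" "x \<noteq> y"
  shows "2 * card {\<sigma>. \<sigma> permutes S \<and> evenperm \<sigma>} = fact (card S)"
proof -
  let ?E = "{\<sigma>. \<sigma> permutes S \<and> evenperm \<sigma>}" and ?O = "{\<sigma>. \<sigma> permutes S \<and> \<not> evenperm \<sigma>}"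
  \<comment> \<open>Composition with a fixed transposition is an involution exchanging the two
    parities.\<close>
  let ?t = "\<lambda>\<sigma>. transpose x y \<circ> \<sigma>"
  have perm: "permutation \<sigma>" if "\<sigma> permutes S" for \<sigma>
    using that assms(1) by (rule permutes_imp_permutation[rotated])
  have t: "?t \<sigma> permutes S" "evenperm (?t \<sigma>) \<longleftrightarrow> \<not> evenperm \<sigma>" if "\<sigma> permutes S" for \<sigma>
    using that assms perm by (auto intro!: permutes_compose permutes_swap_id
        simp: evenperm_comp permutation_swap_id evenperm_swap)
  have tt: "?t (?t \<sigma>) = \<sigma>" for \<sigma>
    by (simp add: comp_assoc[symmetric])
  have "bij_betw ?t ?E ?O"
    by (rule bij_betw_byWitness[of _ ?t]) (use t tt in auto)
  then have "card ?E = card ?O" by (rule bij_betw_same_card)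
  moreover have "card ?E + card ?O = card (?E \<union> ?O)"
    using assms(1) by (intro card_Un_disjoint[symmetric]) (auto simp: finite_permutations)
  moreover have "?E \<union> ?O = {\<sigma>. \<sigma> permutes S}" by blast
  ultimately show ?thesis
    using assms(1) by (simp add: card_permutations)
qed

text \<open>Here \<open>c\<close> stands for the size of the orbit. With k = r div 2 at least 2, r!
  is at least (k + 1)! and so at least 3 k!, which excludes c = 1. Two selector vertices are needed
  later: each then has a neighbour that no port has.\<close>

lemma fact_quotient_ge_2:
  fixes c :: nat
  assumes "2 * (c * fact (r div 2)) = fact r" "r \<ge> 4"
  shows "c \<ge> 2"
proof (rule ccontr)
  let ?k = "r div 2"
  assume "\<not> c \<ge> 2"
  then have "c \<le> 1" by linarith
  then have "c * fact ?k \<le> 1 * (fact ?k :: nat)"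
    by (intro mult_right_mono) auto
  then have "fact r \<le> 2 * (fact ?k :: nat)"
    using assms(1) by linarith
  also have "\<dots> < 3 * fact ?k" by simp
  also have "\<dots> \<le> Suc ?k * fact ?k"
    using assms(2) by (intro mult_right_mono) auto
  also have "\<dots> = fact (Suc ?k)" by simp
  also have "\<dots> \<le> fact r"
    using assms(2) by (intro fact_mono) linarith
  finally show False by simp
qed

context seed begin

abbreviation "\<F> \<equiv> seed_family r a d"

lemma seed_family_perm_closed:
  assumes "\<sigma> permutes {1..r}" "evenperm \<sigma>" "F \<in> \<F>"
  shows "perm_graph \<sigma> F \<in> \<F>"
proof -
  obtain \<rho> where \<rho>: "F = perm_graph \<rho> X" "\<rho> permutes {1..r}" "evenperm \<rho>"
    using assms(3) by (auto simp: seed_family_def)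
  have "permutation \<rho>" "permutation \<sigma>"
    using \<rho> assms by (auto intro: permutes_imp_permutation[rotated])
  then have "evenperm (\<sigma> \<circ> \<rho>)" using \<rho> assms by (simp add: evenperm_comp)
  then show ?thesis
    using \<rho> permutes_compose[OF \<rho>(2) assms(1)] unfolding seed_family_def
    by (auto simp: perm_graph_comp[symmetric])
qed

text \<open>Orbit-stabilizer: the relabellings producing a given copy form a coset of the
  stabilizer. Since the stabilizer is contained in the even permutations, each fibre has the full
  size (r/2)!. The product form avoids division of naturals.\<close>

lemma card_seed_family: "2 * (card \<F> * fact (r div 2)) = fact r"
proof -
  let ?E = "{\<sigma>. \<sigma> permutes {1..r} \<and> evenperm \<sigma>}" and ?f = "\<lambda>\<sigma>. perm_graph \<sigma> X"
  have fam: "\<F> = ?f ` ?E" by (auto simp: seed_family_def)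
  have fin: "finite ?E"
    by (rule finite_subset[OF _ finite_permutations[of "{1..r}"]]) auto
  have fibre: "card {\<sigma> \<in> ?E. ?f \<sigma> = F} = fact (r div 2)" if F: "F \<in> ?f ` ?E" for F
  proof -
    obtain \<rho> where \<rho>: "\<rho> permutes {1..r}" "evenperm \<rho>" "F = perm_graph \<rho> X"
      using F by blast
    have perm: "permutation \<rho>" "permutation (inv \<rho>)"
      using permutation_inverse[of \<rho>] permutes_imp_permutation[OF finite_atLeastAtMost \<rho>(1)] by simp_all
    have "{\<sigma> \<in> ?E. ?f \<sigma> = F} = (\<lambda>\<alpha>. \<rho> \<circ> \<alpha>) ` seed_stabilizer r a d"
    proof (intro set_eqI iffI)
      fix \<sigma> assume "\<sigma> \<in> {\<sigma> \<in> ?E. ?f \<sigma> = F}"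
      then have \<sigma>: "\<sigma> permutes {1..r}" "evenperm \<sigma>" "perm_graph \<sigma> X = perm_graph \<rho> X"
        using \<rho> by auto
      have "perm_graph (inv \<rho> \<circ> \<sigma>) X = perm_graph (inv \<rho> \<circ> \<rho>) X"
        by (simp only: perm_graph_comp \<sigma>)
      then have "inv \<rho> \<circ> \<sigma> \<in> seed_stabilizer r a d"
        using \<sigma> \<rho> by (auto simp: seed_stabilizer_def permutes_inv_o intro!: permutes_compose permutes_inv)
      moreover have "\<sigma> = \<rho> \<circ> (inv \<rho> \<circ> \<sigma>)"
        by (simp add: comp_assoc[symmetric] permutes_inv_o[OF \<rho>(1)])
      ultimately show "\<sigma> \<in> (\<lambda>\<alpha>. \<rho> \<circ> \<alpha>) ` seed_stabilizer r a d" by blast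
    next
      fix \<sigma> assume "\<sigma> \<in> (\<lambda>\<alpha>. \<rho> \<circ> \<alpha>) ` seed_stabilizer r a d"
      then obtain \<alpha> where \<alpha>: "\<sigma> = \<rho> \<circ> \<alpha>" "\<alpha> \<in> seed_stabilizer r a d" by blast
      then have \<alpha>': "\<alpha> permutes {1..r}" "perm_graph \<alpha> X = X" "evenperm \<alpha>"
        using evenperm_stabilizer by (auto simp: seed_stabilizer_def)
      then have "permutation \<alpha>" by (auto intro: permutes_imp_permutation[rotated])
      then show "\<sigma> \<in> {\<sigma> \<in> ?E. ?f \<sigma> = F}"
        using \<alpha> \<alpha>' \<rho> perm by (auto simp: perm_graph_comp evenperm_comp intro!: permutes_compose)
    qed
    moreover have "inj_on (\<lambda>\<alpha>. \<rho> \<circ> \<alpha>) (seed_stabilizer r a d)"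
      using permutes_inj[OF \<rho>(1)] by (intro inj_onI) (simp add: fun_eq_iff inj_def)
    ultimately show ?thesis by (simp add: card_image card_stabilizer)
  qed
  have "card ?E = (\<Sum>F\<in>?f ` ?E. card {\<sigma> \<in> ?E. ?f \<sigma> = F})"
    using sum.image_gen[OF fin, of "\<lambda>_. 1::nat" ?f] by (simp only: card_eq_sum)
  also have "\<dots> = (\<Sum>F\<in>?f ` ?E. fact (r div 2))"
    using fibre by (rule sum.cong[OF refl])
  also have "\<dots> = card \<F> * fact (r div 2)"
    by (simp only: fam sum_constant of_nat_id)
  finally have "card ?E = card \<F> * fact (r div 2)" .
  moreover have "2 * card ?E = fact (card {1..r})"
    using r_ge_4 by (intro card_even_permutations[of _ 1 2]) auto
  ultimately show ?thesis by (simp only: card_atLeastAtMost diff_Suc_1)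
qed

lemmas card_seed_family_ge_2 = fact_quotient_ge_2[OF card_seed_family r_ge_4]

end

section \<open>Isomorphisms, decks and blow-ups\<close>

text \<open>Arcs are pairs, so \<open>map_prod h h\<close> is the arc map. The condition
  \<open>ends\<close> replaces the type of pair graphs because cards, as results of
  \<open>del_vert\<close>, are general digraphs.\<close>

lemma digraph_isoI:
  fixes G :: "('a, 'a \<times> 'a) pre_digraph" and H :: "('b, 'b \<times> 'b) pre_digraph"
  assumes wf: "wf_digraph G" "wf_digraph H"
    and ends: "tail G = fst" "head G = snd" "tail H = fst" "head H = snd"
    and bij: "bij_betw h (verts G) (verts H)"
    and arc: "\<And>u v. u \<in> verts G \<Longrightarrow> v \<in> verts G \<Longrightarrow> (u, v) \<in> arcs G \<longleftrightarrow> (h u, h v) \<in> arcs H"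
  shows "digraph_iso G H"
proof -
  define f where "f = \<lparr>iso_verts = h, iso_arcs = map_prod h h, iso_head = (snd :: 'b \<times> 'b \<Rightarrow> 'b), iso_tail = fst\<rparr>"
  have verts: "u \<in> verts G" "v \<in> verts G" if "(u, v) \<in> arcs G" for u v
    using wf_digraph.tail_in_verts[OF wf(1) that] wf_digraph.head_in_verts[OF wf(1) that] ends by simp_all
  have verts': "u \<in> verts H" "v \<in> verts H" if "(u, v) \<in> arcs H" for u v
    using wf_digraph.tail_in_verts[OF wf(2) that] wf_digraph.head_in_verts[OF wf(2) that] ends by simp_all
  have inj: "inj_on h (verts G)" and img: "h ` verts G = verts H"
    using bij by (auto simp: bij_betw_def)
  have "inj_on (map_prod h h) (arcs G)"
    by (rule inj_on_subset[OF map_prod_inj_on[OF inj inj]]) (use verts in auto)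
  then have iso: "pre_digraph.digraph_isomorphism G f"
    using wf inj by (auto simp: pre_digraph.digraph_isomorphism_def f_def ends)
  have "arcs H = map_prod h h ` arcs G"
  proof (intro set_eqI iffI)
    fix e assume e: "e \<in> arcs H"
    obtain x y where xy: "e = (x, y)" by (cases e)
    then obtain u v where "u \<in> verts G" "v \<in> verts G" "x = h u" "y = h v"
      using e verts' img by blast
    then show "e \<in> map_prod h h ` arcs G"
      using arc e xy by (metis image_eqI map_prod_simp)
  next
    fix e assume "e \<in> map_prod h h ` arcs G"
    then obtain u v where "(u, v) \<in> arcs G" "e = (h u, h v)" by auto
    then show "e \<in> arcs H" using arc verts by blast
  qed
  then have "H = app_iso f G"
    using img ends by (intro pre_digraph.equality) (auto simp: app_iso_def f_def)
  with iso show ?thesis unfolding digraph_iso_def by blast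
qed

text \<open>The arc map carries no information of its own: endpoints are the components of an arc,
  so the vertex map determines it.\<close>

lemma digraph_isoE:
  fixes G :: "'a pair_pre_digraph" and H :: "'b pair_pre_digraph"
  assumes "digraph_iso G H"
  obtains h where "bij_betw h (pverts G) (pverts H)"
    "\<And>u v. u \<in> pverts G \<Longrightarrow> v \<in> pverts G \<Longrightarrow> (u, v) \<in> parcs G \<longleftrightarrow> (h u, h v) \<in> parcs H"
proof -
  obtain f where f: "pre_digraph.digraph_isomorphism (with_proj G) f" "with_proj H = app_iso f (with_proj G)"
    using assms unfolding digraph_iso_def by blast
  define h where "h = iso_verts f"
  have wf: "wf_digraph (with_proj G)" and inj: "inj_on h (pverts G)"
    using f(1) by (auto simp: pre_digraph.digraph_isomorphism_def h_def)
  have H: "pverts H = h ` pverts G" "parcs H = iso_arcs f ` parcs G"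
    "fst = iso_tail f" "snd = iso_head f"
    using arg_cong[OF f(2), of verts] arg_cong[OF f(2), of arcs]
      arg_cong[OF f(2), of tail] arg_cong[OF f(2), of head]
    by (simp_all add: app_iso_def h_def)
  have ends: "iso_arcs f (u, v) = (h u, h v)" if "(u, v) \<in> parcs G" for u v
  proof -
    have "fst (iso_arcs f (u, v)) = h u" "snd (iso_arcs f (u, v)) = h v"
      using f(1) that unfolding H(3,4) by (auto simp: pre_digraph.digraph_isomorphism_def h_def)
    then show ?thesis by (simp add: prod_eq_iff)
  qed
  have verts: "u \<in> pverts G" "v \<in> pverts G" if "(u, v) \<in> parcs G" for u v
    using wf_digraph.tail_in_verts[OF wf] wf_digraph.head_in_verts[OF wf] that by fastforce+
  have "(u, v) \<in> parcs G \<longleftrightarrow> (h u, h v) \<in> parcs H" if uv: "u \<in> pverts G" "v \<in> pverts G" for u v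
  proof
    assume "(u, v) \<in> parcs G"
    then show "(h u, h v) \<in> parcs H" using ends H(2) by (metis imageI)
  next
    assume "(h u, h v) \<in> parcs H"
    then obtain u' v' where e: "(u', v') \<in> parcs G" "(h u, h v) = iso_arcs f (u', v')"
      using H(2) by auto
    then have "h u = h u'" "h v = h v'" using ends by auto
    then have "u = u'" "v = v'" using inj uv verts[OF e(1)] by (auto dest: inj_onD)
    then show "(u, v) \<in> parcs G" using e by simp
  qed
  then show thesis using that[of h] inj H(1) by (simp add: bij_betw_def)
qed

text \<open>Bijections between corresponding fibres glue to one map over \<open>\<psi>\<close>. Only
  the fibre sizes matter, which absorbs the gap that a deleted copy leaves in the numbering.\<close>

lemma ex_fibrewise_bij:
  assumes U: "U \<subseteq> P \<times> UNIV" and U': "U' \<subseteq> \<psi> ` P \<times> UNIV" and inj: "inj_on \<psi> P"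
    and fin: "\<And>v. v \<in> P \<Longrightarrow> finite {c. (v, c) \<in> U}" "\<And>v. v \<in> P \<Longrightarrow> finite {c. (\<psi> v, c) \<in> U'}"
    and card: "\<And>v. v \<in> P \<Longrightarrow> card {c. (v, c) \<in> U} = card {c. (\<psi> v, c) \<in> U'}"
  shows "\<exists>h. bij_betw h U U' \<and> (\<forall>u \<in> U. fst (h u) = \<psi> (fst u))"
proof -
  have "\<forall>v\<in>P. \<exists>k. bij_betw k {c. (v, c) \<in> U} {c. (\<psi> v, c) \<in> U'}"
    using fin card by (intro ballI finite_same_card_bij)
  then obtain k where k: "\<And>v. v \<in> P \<Longrightarrow> bij_betw (k v) {c. (v, c) \<in> U} {c. (\<psi> v, c) \<in> U'}"
    by metis
  define h where "h = (\<lambda>(v, c). (\<psi> v, k v c))"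
  have "inj_on h U"
  proof (rule inj_onI)
    fix x y assume xy: "x \<in> U" "y \<in> U" "h x = h y"
    obtain v c w c' where vc: "x = (v, c)" "y = (w, c')" by (metis surj_pair)
    then have P: "v \<in> P" "w \<in> P" using xy U by auto
    have "v = w" using xy vc P inj by (auto simp: h_def dest: inj_onD)
    moreover from this have "c = c'"
      using k[OF P(1)] xy vc by (auto simp: h_def bij_betw_def dest: inj_onD)
    ultimately show "x = y" using vc by simp
  qed
  moreover have "h ` U = U'"
  proof (intro set_eqI iffI)
    fix y assume "y \<in> h ` U"
    then obtain v c where vc: "(v, c) \<in> U" "y = (\<psi> v, k v c)" by (auto simp: h_def)
    then have "v \<in> P" using U by auto
    then show "y \<in> U'" using k[of v] vc by (auto simp: bij_betw_def)
  next
    fix y assume y: "y \<in> U'"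
    then obtain v c' where v: "v \<in> P" "y = (\<psi> v, c')" using U' by force
    then have "c' \<in> k v ` {c. (v, c) \<in> U}" using k[of v] y by (auto simp: bij_betw_def)
    then obtain c where "(v, c) \<in> U" "c' = k v c" by blast
    then show "y \<in> h ` U" using v by (force simp: h_def)
  qed
  ultimately show ?thesis
    by (intro exI[of _ h]) (auto simp: bij_betw_def h_def)
qed

lemma blow_up_arc: "(x, y) \<in> parcs (blow_up m S) \<longleftrightarrow>
   (fst x, fst y) \<in> parcs S \<and> snd x < m (fst x) \<and> snd y < m (fst y)"
  by (cases x; cases y) (simp add: blow_up_def)

lemma blow_up_vert: "x \<in> pverts (blow_up m S) \<longleftrightarrow> fst x \<in> pverts S \<and> snd x < m (fst x)"
  by (cases x) (simp add: blow_up_def)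

text \<open>Adjacency in a blow-up depends on the base vertices alone, so every bijection lying over
  an automorphism of \<open>S\<close> preserves it. The truncated subtraction in \<open>mult\<close>
  is exact: the fibres of \<open>x\<close> and \<open>y\<close> are not empty.\<close>

lemma blow_up_del_vert_iso:
  assumes S: "pair_graph S"
    and x: "x \<in> pverts (blow_up m S)" and y: "y \<in> pverts (blow_up m' S)"
    and bij: "bij_betw \<psi> (pverts S) (pverts S)"
    and arc: "\<And>u v. u \<in> pverts S \<Longrightarrow> v \<in> pverts S \<Longrightarrow> (u, v) \<in> parcs S \<longleftrightarrow> (\<psi> u, \<psi> v) \<in> parcs S"
    and mult: "\<And>v. v \<in> pverts S \<Longrightarrow> m' (\<psi> v) - of_bool (\<psi> v = fst y) = m v - of_bool (v = fst x)"
  shows "digraph_iso (pre_digraph.del_vert (blow_up m S) x) (pre_digraph.del_vert (blow_up m' S) y)"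
proof -
  let ?U = "pverts (blow_up m S) - {x}" and ?U' = "pverts (blow_up m' S) - {y}"
  have fibre: "{c. (v, c) \<in> ?U} = {..<m v} - (if v = fst x then {snd x} else {})"
      "card {c. (v, c) \<in> ?U} = m v - of_bool (v = fst x)" if "v \<in> pverts S" for v
  proof -
    show eq: "{c. (v, c) \<in> ?U} = {..<m v} - (if v = fst x then {snd x} else {})"
      using that by (cases x) (auto simp: blow_up_vert)
    show "card {c. (v, c) \<in> ?U} = m v - of_bool (v = fst x)"
      unfolding eq using x by (auto simp: blow_up_vert)
  qed
  have fibre': "{c. (v, c) \<in> ?U'} = {..<m' v} - (if v = fst y then {snd y} else {})"
      "card {c. (v, c) \<in> ?U'} = m' v - of_bool (v = fst y)" if "v \<in> pverts S" for v
  proof -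
    show eq: "{c. (v, c) \<in> ?U'} = {..<m' v} - (if v = fst y then {snd y} else {})"
      using that by (cases y) (auto simp: blow_up_vert)
    show "card {c. (v, c) \<in> ?U'} = m' v - of_bool (v = fst y)"
      unfolding eq using y by (auto simp: blow_up_vert)
  qed
  have \<psi>: "\<psi> v \<in> pverts S" if "v \<in> pverts S" for v
    using bij that by (auto simp: bij_betw_def)
  have img: "\<psi> ` pverts S = pverts S" using bij by (auto simp: bij_betw_def)
  have "\<exists>h. bij_betw h ?U ?U' \<and> (\<forall>u \<in> ?U. fst (h u) = \<psi> (fst u))"
  proof (rule ex_fibrewise_bij)
    show "?U \<subseteq> pverts S \<times> UNIV" "?U' \<subseteq> \<psi> ` pverts S \<times> UNIV"
      unfolding img by (auto simp: blow_up_vert)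
    show "inj_on \<psi> (pverts S)" using bij by (auto simp: bij_betw_def)
    show "finite {c. (v, c) \<in> ?U}" "finite {c. (\<psi> v, c) \<in> ?U'}"
      "card {c. (v, c) \<in> ?U} = card {c. (\<psi> v, c) \<in> ?U'}" if "v \<in> pverts S" for v
      using fibre[OF that] fibre'[OF \<psi>[OF that]] mult[OF that] by simp_all
  qed
  then obtain h where h: "bij_betw h ?U ?U'" "\<And>u. u \<in> ?U \<Longrightarrow> fst (h u) = \<psi> (fst u)" by blast
  have hU: "h u \<in> ?U'" if "u \<in> ?U" for u using h(1) that by (auto simp: bij_betw_def)
  show ?thesis
  proof (rule digraph_isoI[where h = h])
    fix u v assume "u \<in> verts (pre_digraph.del_vert (blow_up m S) x)" "v \<in> verts (pre_digraph.del_vert (blow_up m S) x)"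
    then have uv: "u \<in> ?U" "v \<in> ?U" by (simp_all add: pre_digraph.del_vert_simps)
    then have "u \<in> pverts (blow_up m S)" "v \<in> pverts (blow_up m S)"
      "h u \<in> pverts (blow_up m' S)" "h v \<in> pverts (blow_up m' S)" "h u \<noteq> y" "h v \<noteq> y"
      using hU by blast+
    then show "(u, v) \<in> arcs (pre_digraph.del_vert (blow_up m S) x) \<longleftrightarrow>
        (h u, h v) \<in> arcs (pre_digraph.del_vert (blow_up m' S) y)"
      using uv arc[of "fst u" "fst v"] h(2)[OF uv(1)] h(2)[OF uv(2)]
      by (simp add: pre_digraph.del_vert_simps blow_up_arc blow_up_vert)
  qed (use h(1) in \<open>simp_all add: pre_digraph.del_vert_simps wf_digraph_del_vert_pair_graph pair_graph_blow_up S\<close>)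
qed

text \<open>The cards indexed by \<open>W\<close>, counted with multiplicity, form a submultiset of
  both decks; injectivity of \<open>g\<close> ensures this on the side of \<open>H\<close>.\<close>

lemma card_le_common_cards:
  fixes G :: "'a pair_pre_digraph"
  assumes G: "pair_graph G" and H: "pair_graph H"
    and W: "W \<subseteq> pverts G" and g: "g ` W \<subseteq> pverts H" "inj_on g W"
    and iso: "\<And>v. v \<in> W \<Longrightarrow> digraph_iso (pre_digraph.del_vert G v) (pre_digraph.del_vert H (g v))"
  shows "card W \<le> common_cards G H"
proof -
  have fin: "finite (pverts G)" "finite (pverts H)"
    using G H by (auto simp: pair_graph_def pair_digraph_def pair_fin_digraph_def pair_fin_digraph_axioms_def)
  let ?f = "\<lambda>v. iso_class (pre_digraph.del_vert (with_proj G) v)"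
  let ?f' = "\<lambda>v. iso_class (pre_digraph.del_vert (with_proj H) v)"
  let ?M = "image_mset ?f (mset_set W)"
  have "?M \<subseteq># deck G"
    unfolding deck_def using W fin
    by (intro image_mset_subseteq_mono) (simp add: subset_imp_msubset_mset_set)
  moreover have "?M \<subseteq># deck H"
  proof -
    have "?f v = ?f' (g v)" if "v \<in> W" for v
      using iso[OF that] wf_digraph_del_vert_pair_graph[OF G] wf_digraph_del_vert_pair_graph[OF H]
      by (simp add: iso_class_eq_iff)
    then have "?M = image_mset (\<lambda>v. ?f' (g v)) (mset_set W)"
      using finite_subset[OF W fin(1)] by (intro image_mset_cong) simp
    also have "\<dots> = image_mset ?f' (mset_set (g ` W))"
      unfolding image_mset_mset_set[OF g(2), symmetric] by (simp add: multiset.map_comp comp_def)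
    also have "\<dots> \<subseteq># deck H"
      unfolding deck_def using g(1) fin
      by (intro image_mset_subseteq_mono) (simp add: subset_imp_msubset_mset_set)
    finally show ?thesis .
  qed
  ultimately have "?M \<subseteq># deck G \<inter># deck H" by simp
  then have "size ?M \<le> common_cards G H"
    unfolding common_cards_def by (rule size_mset_mono)
  then show ?thesis by simp
qed

text \<open>The neighbourhood bijection may vary with \<open>u\<close> and need not be induced by
  \<open>h\<close>. This freedom is essential, since the graphs compared later are not
  isomorphic.\<close>

lemma degree_multiset_eqI:
  fixes G :: "'a pair_pre_digraph" and H :: "'b pair_pre_digraph"
  assumes bij: "bij_betw h (pverts G) (pverts H)"
    and deg: "\<And>u. u \<in> pverts G \<Longrightarrow> \<exists>g. bij_betw g {v. (u, v) \<in> parcs G} {v. (h u, v) \<in> parcs H}"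
  shows "degree_multiset G = degree_multiset H"
proof -
  have out: "out_degree (with_proj D) u = card {v. (u, v) \<in> parcs D}" for D :: "'c pair_pre_digraph" and u
  proof -
    have "out_arcs (with_proj D) u = Pair u ` {v. (u, v) \<in> parcs D}"
      by (auto simp: out_arcs_def)
    then show ?thesis by (simp add: out_degree_def card_image inj_on_def)
  qed
  have eq: "out_degree (with_proj G) u = out_degree (with_proj H) (h u)" if "u \<in> pverts G" for u
    using deg[OF that] bij_betw_same_card unfolding out by blast
  have "degree_multiset H = image_mset (out_degree (with_proj H)) (mset_set (h ` pverts G))"
    using bij by (simp add: degree_multiset_def bij_betw_def)
  also have "\<dots> = image_mset (\<lambda>u. out_degree (with_proj H) (h u)) (mset_set (pverts G))"
    unfolding image_mset_mset_set[OF bij_betw_imp_inj_on[OF bij], symmetric]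
    by (simp add: multiset.map_comp comp_def)
  also have "\<dots> = degree_multiset G"
    unfolding degree_multiset_def using eq
    by (cases "finite (pverts G)") (auto intro!: image_mset_cong)
  finally show ?thesis by simp
qed

lemma connectedI_hub:
  fixes G :: "'a pair_pre_digraph"
  assumes "w \<in> pverts G"
    and hub: "\<And>v. v \<in> pverts G \<Longrightarrow> (v, w) \<in> rtrancl_on (pverts G) ((parcs G)\<^sup>s)"
  shows "Digraph_Component.connected G"
proof -
  have "sym ((parcs G)\<^sup>s)" by (auto simp: sym_def symcl_iff)
  then have "sym (rtrancl_on (pverts G) ((parcs G)\<^sup>s))" by (rule rtrancl_on_sym)
  then have "(u, v) \<in> rtrancl_on (pverts G) ((parcs G)\<^sup>s)" if "u \<in> pverts G" "v \<in> pverts G" for u v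
    using hub[OF that(1)] hub[OF that(2)] by (meson rtrancl_on_trans symD)
  then show ?thesis using assms(1) by (auto simp: connected_conv)
qed

section \<open>Relabelling the selector\<close>

text \<open>The map \<open>\<phi>\<close> is independent of \<open>\<sigma>\<close>: isomorphisms
  take \<open>perm_graph \<sigma>\<close>, but for odd \<open>\<sigma>\<close> that map leaves the
  family, and the degree comparison uses the identity or the action of an even permutation
  instead.\<close>

fun relabel :: "(nat \<Rightarrow> nat) \<Rightarrow> (nat pair_pre_digraph \<Rightarrow> nat pair_pre_digraph) \<Rightarrow> sel_vertex \<Rightarrow> sel_vertex" where
  "relabel \<sigma> \<phi> (Port i) = Port (\<sigma> i)"
| "relabel \<sigma> \<phi> (PairVertex e) = PairVertex (\<sigma> ` e)"
| "relabel \<sigma> \<phi> (SelVertex F) = SelVertex (\<phi> F)"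

text \<open>Adjacency in unordered form, to match the sets that index pair vertices.\<close>

definition has_edge :: "'a pair_pre_digraph \<Rightarrow> 'a set \<Rightarrow> bool" where
  "has_edge F e \<longleftrightarrow> (\<exists>i j. e = {i, j} \<and> (i, j) \<in> parcs F)"

lemma has_edge_perm_graph:
  assumes "inj \<sigma>"
  shows "has_edge (perm_graph \<sigma> F) (\<sigma> ` e) \<longleftrightarrow> has_edge F e"
proof
  assume "has_edge (perm_graph \<sigma> F) (\<sigma> ` e)"
  then obtain i j where "\<sigma> ` e = {\<sigma> i, \<sigma> j}" "(i, j) \<in> parcs F"
    by (auto simp: has_edge_def perm_graph_def)
  moreover from this have "e = {i, j}"
    using inj_image_eq_iff[OF assms, of e "{i, j}"] by simp
  ultimately show "has_edge F e" by (auto simp: has_edge_def)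
next
  assume "has_edge F e"
  then obtain i j where "e = {i, j}" "(i, j) \<in> parcs F" by (auto simp: has_edge_def)
  then show "has_edge (perm_graph \<sigma> F) (\<sigma> ` e)"
    using perm_graph_arc_iff[OF assms, of i j F] by (auto simp: has_edge_def)
qed

lemma (in pair_graph) has_edge_doubleton: "has_edge G {i, j} \<longleftrightarrow> (i, j) \<in> parcs G"
  unfolding has_edge_def using arcs_symmetric by (auto simp: doubleton_eq_iff)

lemma selector_arc [simp]:
  "(Port i, Port j) \<notin> parcs (selector r \<F>)"
  "(Port i, PairVertex e) \<in> parcs (selector r \<F>) \<longleftrightarrow> e \<subseteq> {1..r} \<and> card e = 2 \<and> i \<in> e"
  "(Port i, SelVertex F) \<notin> parcs (selector r \<F>)"
  "(PairVertex e, Port i) \<in> parcs (selector r \<F>) \<longleftrightarrow> e \<subseteq> {1..r} \<and> card e = 2 \<and> i \<in> e"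
  "(PairVertex e, PairVertex e') \<notin> parcs (selector r \<F>)"
  "(PairVertex e, SelVertex F) \<in> parcs (selector r \<F>) \<longleftrightarrow> F \<in> \<F> \<and> has_edge F e"
  "(SelVertex F, Port i) \<notin> parcs (selector r \<F>)"
  "(SelVertex F, PairVertex e) \<in> parcs (selector r \<F>) \<longleftrightarrow> F \<in> \<F> \<and> has_edge F e"
  "(SelVertex F, SelVertex F') \<in> parcs (selector r \<F>) \<longleftrightarrow> F \<in> \<F> \<and> F' \<in> \<F> \<and> F \<noteq> F'"
  unfolding selector_def has_edge_def pair_pre_digraph.simps symcl_iff by auto

lemma selector_vert [simp]:
  "Port i \<in> pverts (selector r \<F>) \<longleftrightarrow> i \<in> {1..r}"
  "PairVertex e \<in> pverts (selector r \<F>) \<longleftrightarrow> e \<subseteq> {1..r} \<and> card e = 2"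
  "SelVertex F \<in> pverts (selector r \<F>) \<longleftrightarrow> F \<in> \<F>"
  unfolding selector_def pair_pre_digraph.simps by auto

text \<open>Swapping the two elements of \<open>e\<close> before applying \<open>\<tau>\<close>
  changes the parity but not the image of \<open>e\<close>.\<close>

lemma ex_evenperm_image:
  assumes \<tau>: "\<tau> permutes S" and S: "finite S" "e \<subseteq> S" "card e = 2"
  shows "\<exists>\<rho>. \<rho> permutes S \<and> evenperm \<rho> \<and> \<rho> ` e = \<tau> ` e"
proof (cases "evenperm \<tau>")
  case True
  then show ?thesis using \<tau> by blast
next
  case False
  obtain i j where e: "e = {i, j}" "i \<noteq> j" using S(3) by (auto simp: card_2_iff)
  have "\<tau> \<circ> transpose i j permutes S"
    using e S by (intro permutes_compose \<tau> permutes_swap_id) auto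
  moreover have "evenperm (\<tau> \<circ> transpose i j)"
    using False e permutes_imp_permutation[OF S(1) \<tau>]
    by (simp add: evenperm_comp permutation_swap_id evenperm_swap)
  moreover have "(\<tau> \<circ> transpose i j) ` e = \<tau> ` e"
    using e by (auto simp: transpose_def)
  ultimately show ?thesis by blast
qed

lemma bij_betw_neighbours:
  assumes "bij_betw f V V'"
    and "\<And>v. v \<in> V \<Longrightarrow> (u, v) \<in> E \<longleftrightarrow> (u', f v) \<in> E'"
    and "{v. (u, v) \<in> E} \<subseteq> V" "{v. (u', v) \<in> E'} \<subseteq> V'"
  shows "bij_betw f {v. (u, v) \<in> E} {v. (u', v) \<in> E'}"
proof (rule bij_betw_subset[OF assms(1,3)])
  show "f ` {v. (u, v) \<in> E} = {v. (u', v) \<in> E'}"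
    using assms unfolding bij_betw_def by blast
qed

context seed begin

abbreviation "S \<equiv> selector r \<F>"
abbreviation "blown \<equiv> selector_blow_up r a d"

lemma pair_graph_S: "pair_graph S"
  using labeling seed_family_graph finite_seed_family by (intro pair_graph_selector) auto

lemma pair_graph_blown: "pair_graph (blown s)"
  by (rule pair_graph_selector_blow_up[OF labeling])

lemma blown_arc: "(x, y) \<in> parcs (blown s) \<longleftrightarrow>
    (fst x, fst y) \<in> parcs S \<and> snd x < port_mult s (fst x) \<and> snd y < port_mult s (fst y)"
  unfolding selector_blow_up_def by (rule blow_up_arc)

lemma blown_vert: "x \<in> pverts (blown s) \<longleftrightarrow> fst x \<in> pverts S \<and> snd x < port_mult s (fst x)"
  unfolding selector_blow_up_def by (rule blow_up_vert)

lemma blown_arc_verts: "(x, y) \<in> parcs (blown s) \<Longrightarrow> x \<in> pverts (blown s) \<and> y \<in> pverts (blown s)"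
proof -
  interpret pair_graph "blown s" by (rule pair_graph_blown)
  show "(x, y) \<in> parcs (blown s) \<Longrightarrow> x \<in> pverts (blown s) \<and> y \<in> pverts (blown s)"
    using in_arcsD1 in_arcsD2 by blast
qed

lemma blown_cases:
  assumes "x \<in> pverts (blown s)"
  obtains (port) i c where "x = (Port i, c)" "i \<in> {1..r}" "c < s i"
  | (pair) e where "x = (PairVertex e, 0)" "e \<subseteq> {1..r}" "card e = 2"
  | (sel) F where "x = (SelVertex F, 0)" "F \<in> \<F>"
proof -
  obtain v c where x: "x = (v, c)" by fastforce
  show thesis
    using assms that unfolding x blown_vert by (cases v) (auto simp del: atLeastAtMost_iff)
qed

lemma bij_betw_relabel:
  assumes \<sigma>: "\<sigma> permutes {1..r}" and \<phi>: "bij_betw \<phi> \<F> \<F>"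
  shows "bij_betw (relabel \<sigma> \<phi>) (pverts S) (pverts S)"
proof -
  have \<sigma>': "inv \<sigma> permutes {1..r}" by (rule permutes_inv[OF \<sigma>])
  have img: "\<rho> ` e \<subseteq> {1..r} \<and> card (\<rho> ` e) = 2"
    if "\<rho> permutes {1..r}" "e \<subseteq> {1..r} \<and> card e = 2" for \<rho> e
    using that permutes_image[OF that(1)] permutes_inj[OF that(1)]
    by (metis card_image image_mono inj_on_subset subset_UNIV)
  have mem: "relabel \<rho> \<psi> v \<in> pverts S"
    if "\<rho> permutes {1..r}" "bij_betw \<psi> \<F> \<F>" "v \<in> pverts S" for \<rho> \<psi> v
    using that img[OF that(1)] permutes_in_image[OF that(1)]
    by (cases v) (simp_all add: bij_betwE del: atLeastAtMost_iff)
  have inv: "bij_betw (inv_into \<F> \<phi>) \<F> \<F>" by (rule bij_betw_inv_into[OF \<phi>])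
  show ?thesis
  proof (rule bij_betw_byWitness[of _ "relabel (inv \<sigma>) (inv_into \<F> \<phi>)"])
    show "\<forall>v\<in>pverts S. relabel (inv \<sigma>) (inv_into \<F> \<phi>) (relabel \<sigma> \<phi> v) = v"
    proof
      fix v assume "v \<in> pverts S"
      then show "relabel (inv \<sigma>) (inv_into \<F> \<phi>) (relabel \<sigma> \<phi> v) = v"
        using permutes_inverses[OF \<sigma>] bij_betw_inv_into_left[OF \<phi>]
        by (cases v) (simp_all add: image_image)
    qed
    show "\<forall>v\<in>pverts S. relabel \<sigma> \<phi> (relabel (inv \<sigma>) (inv_into \<F> \<phi>) v) = v"
    proof
      fix v assume "v \<in> pverts S"
      then show "relabel \<sigma> \<phi> (relabel (inv \<sigma>) (inv_into \<F> \<phi>) v) = v"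
        using permutes_inverses[OF \<sigma>] bij_betw_inv_into_right[OF \<phi>]
        by (cases v) (simp_all add: image_image)
    qed
  qed (use mem[OF \<sigma> \<phi>] mem[OF \<sigma>' inv] in blast)+
qed

lemma bij_betw_perm_graph:
  assumes "\<sigma> permutes {1..r}" "evenperm \<sigma>"
  shows "bij_betw (perm_graph \<sigma>) \<F> \<F>"
proof -
  have "inj_on (perm_graph \<sigma>) \<F>"
    using perm_graph_inj[OF permutes_bij[OF assms(1)]] by (rule inj_onI)
  moreover have "perm_graph \<sigma> ` \<F> \<subseteq> \<F>"
    using seed_family_perm_closed[OF assms] by blast
  ultimately show ?thesis
    by (simp add: bij_betw_def endo_inj_surj finite_seed_family)
qed

lemma image_pair_iff:
  assumes "\<sigma> permutes {1..r}"
  shows "\<sigma> ` e \<subseteq> {1..r} \<longleftrightarrow> e \<subseteq> {1..r}" "card (\<sigma> ` e) = card e" "\<sigma> i \<in> \<sigma> ` e \<longleftrightarrow> i \<in> e"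
proof -
  have inj: "inj \<sigma>" by (rule permutes_inj[OF assms])
  show "\<sigma> ` e \<subseteq> {1..r} \<longleftrightarrow> e \<subseteq> {1..r}"
    using permutes_in_image[OF assms] by (auto simp del: atLeastAtMost_iff)
  show "card (\<sigma> ` e) = card e" by (rule card_image[OF inj_on_subset[OF inj subset_UNIV]])
  show "\<sigma> i \<in> \<sigma> ` e \<longleftrightarrow> i \<in> e" using inj by (simp add: inj_image_mem_iff)
qed

text \<open>Evenness keeps the relabelled copies of the seed inside the family; all other
  adjacencies respect any permutation.\<close>

lemma selector_automorphism:
  assumes \<sigma>: "\<sigma> permutes {1..r}" "evenperm \<sigma>"
    and uv: "u \<in> pverts S" "v \<in> pverts S"
  shows "(u, v) \<in> parcs S \<longleftrightarrow> (relabel \<sigma> (perm_graph \<sigma>) u, relabel \<sigma> (perm_graph \<sigma>) v) \<in> parcs S"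
proof -
  have eq: "perm_graph \<sigma> F = perm_graph \<sigma> F' \<longleftrightarrow> F = F'" for F F' :: "nat pair_pre_digraph"
    using perm_graph_inj[OF permutes_bij[OF \<sigma>(1)]] by blast
  show ?thesis
    using uv by (cases u; cases v)
      (simp_all add: image_pair_iff[OF \<sigma>(1)] has_edge_perm_graph[OF permutes_inj[OF \<sigma>(1)]]
        seed_family_perm_closed[OF \<sigma>] eq del: atLeastAtMost_iff)
qed

lemma blown_del_vert_iso:
  assumes \<sigma>: "\<sigma> permutes {1..r}" "evenperm \<sigma>"
    and ij: "i \<in> {1..r}" "c < s i" "j \<in> {1..r}" "c' < s' j"
    and mult: "\<And>k. k \<in> {1..r} \<Longrightarrow> s' (\<sigma> k) - of_bool (\<sigma> k = j) = s k - of_bool (k = i)"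
  shows "digraph_iso (pre_digraph.del_vert (blown s) (Port i, c)) (pre_digraph.del_vert (blown s') (Port j, c'))"
  unfolding selector_blow_up_def
proof (rule blow_up_del_vert_iso[OF pair_graph_S, where \<psi> = "relabel \<sigma> (perm_graph \<sigma>)"])
  fix v assume "v \<in> pverts S"
  then show "port_mult s' (relabel \<sigma> (perm_graph \<sigma>) v) - of_bool (relabel \<sigma> (perm_graph \<sigma>) v = fst (Port j, c'))
      = port_mult s v - of_bool (v = fst (Port i, c))"
    using mult by (cases v) (simp_all del: atLeastAtMost_iff)
qed (use ij in \<open>simp_all add: blow_up_vert bij_betw_relabel bij_betw_perm_graph \<sigma> selector_automorphism[OF \<sigma>, symmetric]
      del: atLeastAtMost_iff\<close>)

text \<open>Copy numbers can be kept because corresponding fibres have equal size. Adjacency is not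
  claimed, so \<open>\<sigma>\<close> may be odd.\<close>

lemma bij_betw_blown:
  assumes \<sigma>: "\<sigma> permutes {1..r}" and \<phi>: "bij_betw \<phi> \<F> \<F>"
    and s: "\<And>i. i \<in> {1..r} \<Longrightarrow> s' (\<sigma> i) = s i"
  shows "bij_betw (map_prod (relabel \<sigma> \<phi>) id) (pverts (blown s)) (pverts (blown s'))"
proof -
  note bij = bij_betw_relabel[OF \<sigma> \<phi>]
  have mult: "port_mult s' (relabel \<sigma> \<phi> v) = port_mult s v" if "v \<in> pverts S" for v
    using that s by (cases v) (simp_all del: atLeastAtMost_iff)
  have "inj_on (map_prod (relabel \<sigma> \<phi>) id) (pverts (blown s))"
    by (rule inj_on_subset[OF map_prod_inj_on[OF bij_betw_imp_inj_on[OF bij] inj_on_id[of UNIV]]])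
       (auto simp: blown_vert)
  moreover have "map_prod (relabel \<sigma> \<phi>) id ` pverts (blown s) = pverts (blown s')"
  proof (intro set_eqI iffI)
    fix y assume "y \<in> map_prod (relabel \<sigma> \<phi>) id ` pverts (blown s)"
    then show "y \<in> pverts (blown s')"
      using bij mult by (auto simp: blown_vert bij_betw_def)
  next
    fix y assume y: "y \<in> pverts (blown s')"
    then have "fst y \<in> relabel \<sigma> \<phi> ` pverts S" using bij by (simp add: blown_vert bij_betw_def)
    then obtain v where v: "v \<in> pverts S" "fst y = relabel \<sigma> \<phi> v" by blast
    then have "(v, snd y) \<in> pverts (blown s)" using y mult by (simp add: blown_vert)
    moreover have "y = map_prod (relabel \<sigma> \<phi>) id (v, snd y)" using v by (simp add: prod_eq_iff)
    ultimately show "y \<in> map_prod (relabel \<sigma> \<phi>) id ` pverts (blown s)" by blast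
  qed
  ultimately show ?thesis by (simp add: bij_betw_def)
qed

text \<open>Permuting the multiplicities by an odd permutation does not extend to an isomorphism, yet an even
  permutation with the same effect on a single pair always exists and matches the neighbourhoods of
  the corresponding pair vertices.\<close>

lemma degree_multiset_blown:
  assumes \<tau>: "\<tau> permutes {1..r}" and s: "\<And>i. i \<in> {1..r} \<Longrightarrow> s' (\<tau> i) = s i"
  shows "degree_multiset (blown s) = degree_multiset (blown s')"
proof (rule degree_multiset_eqI)
  let ?h = "map_prod (relabel \<tau> id) id"
  have bij: "bij_betw (map_prod (relabel \<tau> \<phi>) id) (pverts (blown s)) (pverts (blown s'))"
    if "bij_betw \<phi> \<F> \<F>" for \<phi>
    by (rule bij_betw_blown[OF \<tau> that]) (rule s)
  show "bij_betw ?h (pverts (blown s)) (pverts (blown s'))"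
    by (rule bij[OF bij_betw_id])
  have nb: "{v. (x, v) \<in> parcs (blown t)} \<subseteq> pverts (blown t)" for x t
    using blown_arc_verts by blast
  fix u assume "u \<in> pverts (blown s)"
  then show "\<exists>g. bij_betw g {v. (u, v) \<in> parcs (blown s)} {v. (?h u, v) \<in> parcs (blown s')}"
  proof (cases rule: blown_cases)
    case (port i c)
    have "bij_betw ?h {v. (u, v) \<in> parcs (blown s)} {v. (?h u, v) \<in> parcs (blown s')}"
    proof (rule bij_betw_neighbours[OF bij[OF bij_betw_id] _ nb nb])
      fix v assume "v \<in> pverts (blown s)"
      then show "(u, v) \<in> parcs (blown s) \<longleftrightarrow> (?h u, ?h v) \<in> parcs (blown s')"
        using port s by (cases rule: blown_cases)
          (simp_all add: blown_arc image_pair_iff[OF \<tau>] del: atLeastAtMost_iff)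
    qed
    then show ?thesis by blast
  next
    case (pair e)
    obtain \<rho> where \<rho>: "\<rho> permutes {1..r}" "evenperm \<rho>" "\<rho> ` e = \<tau> ` e"
      using ex_evenperm_image[OF \<tau> _ pair(2,3)] by auto
    \<comment> \<open>A hybrid map: ports move by \<open>\<tau>\<close>, which matches the
      multiplicities, and selector vertices by \<open>\<rho>\<close>, which preserves the family.
      The two permutations agree on \<open>e\<close> as a set, which is all that \<open>u\<close>
      sees.\<close>
    let ?g = "map_prod (relabel \<tau> (perm_graph \<rho>)) id"
    have edge: "has_edge (perm_graph \<rho> F) (\<tau> ` e) \<longleftrightarrow> has_edge F e" for F
      using has_edge_perm_graph[OF permutes_inj[OF \<rho>(1)]] \<rho>(3) by metis
    have "bij_betw ?g {v. (u, v) \<in> parcs (blown s)} {v. (?h u, v) \<in> parcs (blown s')}"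
    proof (rule bij_betw_neighbours[OF bij[OF bij_betw_perm_graph[OF \<rho>(1,2)]] _ nb nb])
      fix v assume "v \<in> pverts (blown s)"
      then show "(u, v) \<in> parcs (blown s) \<longleftrightarrow> (?h u, ?g v) \<in> parcs (blown s')"
        using pair s by (cases rule: blown_cases)
          (simp_all add: blown_arc image_pair_iff[OF \<tau>] edge seed_family_perm_closed[OF \<rho>(1,2)]
            del: atLeastAtMost_iff)
    qed
    then show ?thesis by blast
  next
    case (sel F)
    \<comment> \<open>\<open>?h\<close> fixes selector vertices, and no port is adjacent to one, so
      the multiplicities do not affect this neighbourhood.\<close>
    have "(u, v) \<in> parcs (blown s) \<longleftrightarrow> (?h u, v) \<in> parcs (blown s')" for v
      by (cases "fst v") (simp_all add: blown_arc sel)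
    then have "{v. (u, v) \<in> parcs (blown s)} = {v. (?h u, v) \<in> parcs (blown s')}" by blast
    then show ?thesis using bij_betw_id by metis
  qed
qed

end

section \<open>Recognising the ports\<close>

text \<open>As \<open>w\<close> may be \<open>x\<close> or \<open>y\<close>, in a loopless graph
  this excludes adjacency of \<open>x\<close> and \<open>y\<close>: the notion is that of false
  twins.\<close>

definition same_neighbours :: "'a pair_pre_digraph \<Rightarrow> 'a \<Rightarrow> 'a \<Rightarrow> bool" where
  "same_neighbours G x y \<longleftrightarrow> (\<forall>w\<in>pverts G. (x, w) \<in> parcs G \<longleftrightarrow> (y, w) \<in> parcs G)"

definition has_twin :: "'a pair_pre_digraph \<Rightarrow> 'a \<Rightarrow> bool" where
  "has_twin G x \<longleftrightarrow> (\<exists>y\<in>pverts G. y \<noteq> x \<and> same_neighbours G x y)"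

lemma
  assumes bij: "bij_betw h (pverts G) (pverts H)"
    and arc: "\<And>u v. u \<in> pverts G \<Longrightarrow> v \<in> pverts G \<Longrightarrow> (u, v) \<in> parcs G \<longleftrightarrow> (h u, h v) \<in> parcs H"
    and x: "x \<in> pverts G"
  shows same_neighbours_iso: "y \<in> pverts G \<Longrightarrow> same_neighbours H (h x) (h y) \<longleftrightarrow> same_neighbours G x y"
    and has_twin_iso: "has_twin H (h x) \<longleftrightarrow> has_twin G x"
proof -
  have H: "pverts H = h ` pverts G" and inj: "inj_on h (pverts G)"
    using bij by (auto simp: bij_betw_def)
  show same: "same_neighbours H (h x) (h y) \<longleftrightarrow> same_neighbours G x y" if "y \<in> pverts G" for y
    unfolding same_neighbours_def H using arc x that by simp
  show "has_twin H (h x) \<longleftrightarrow> has_twin G x"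
    unfolding has_twin_def H using same x inj by (auto simp: inj_on_eq_iff)
qed

fun is_port :: "sel_vertex \<times> nat \<Rightarrow> bool" where
  "is_port (Port i, c) \<longleftrightarrow> True"
| "is_port _ \<longleftrightarrow> False"

text \<open>The value 0 is a dummy outside \<open>{1..r}\<close>; the index is consulted only at
  ports.\<close>

fun port_index :: "sel_vertex \<times> nat \<Rightarrow> nat" where
  "port_index (Port i, c) = i"
| "port_index _ = 0"

lemma eq_if_same_edges:
  assumes "pair_graph F" "pair_graph F'" "pverts F = V" "pverts F' = V"
    and edge: "\<And>e. e \<subseteq> V \<Longrightarrow> card e = 2 \<Longrightarrow> has_edge F e \<longleftrightarrow> has_edge F' e"
  shows "F = F'"
proof (rule pair_pre_digraph.equality)
  have arc: "(i, j) \<in> parcs K \<longleftrightarrow> {i, j} \<subseteq> V \<and> card {i, j} = 2 \<and> has_edge K {i, j}"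
    if "pair_graph K" "pverts K = V" for i j K
  proof -
    interpret pair_graph K by fact
    have "i \<in> V \<and> j \<in> V \<and> i \<noteq> j" if "(i, j) \<in> parcs K"
      using in_arcsD1[OF that] in_arcsD2[OF that] no_loops'[OF that] \<open>pverts K = V\<close> by blast
    then show ?thesis unfolding has_edge_doubleton by (auto simp: card_2_iff)
  qed
  have "(i, j) \<in> parcs F \<longleftrightarrow> (i, j) \<in> parcs F'" for i j
    using edge[of "{i, j}"] unfolding arc[OF assms(1,3)] arc[OF assms(2,4)] by blast
  then show "parcs F = parcs F'" by auto
qed (use assms in simp_all)

context seed begin

lemma ex_pair_separating:
  assumes "i \<in> {1..r}" "j \<in> {1..r}" "i \<noteq> j"
  shows "\<exists>e \<subseteq> {1..r}. card e = 2 \<and> i \<in> e \<and> j \<notin> e"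
proof -
  \<comment> \<open>Three candidates against two exclusions; the separating pair is
    \<open>{i, k}\<close>.\<close>
  have "\<exists>k \<in> {1, 2, 3}. k \<noteq> i \<and> k \<noteq> j" by auto
  then obtain k where "k \<in> {1, 2, 3}" "k \<noteq> i" "k \<noteq> j" by blast
  moreover from this have "k \<in> {1..r}" using r_ge_4 by auto
  ultimately show ?thesis using assms by (intro exI[of _ "{i, k}"]) auto
qed

text \<open>Copies of different ports are told apart by a pair vertex containing just one of the two
  indices. Port classes are thus visible to isomorphisms.\<close>

lemma same_neighbours_port:
  assumes s: "\<And>i. i \<in> {1..r} \<Longrightarrow> s i \<ge> 1"
    and "x \<in> pverts (blown s)" "y \<in> pverts (blown s)" "is_port x" "is_port y"
  shows "same_neighbours (blown s) x y \<longleftrightarrow> port_index x = port_index y"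
proof -
  obtain i c where x: "x = (Port i, c)" "i \<in> {1..r}" "c < s i"
    using assms(2,4) by (cases rule: blown_cases) auto
  obtain j c' where y: "y = (Port j, c')" "j \<in> {1..r}" "c' < s j"
    using assms(3,5) by (cases rule: blown_cases) auto
  show ?thesis
  proof
    assume same: "same_neighbours (blown s) x y"
    show "port_index x = port_index y"
    proof (rule ccontr)
      assume "port_index x \<noteq> port_index y"
      then have "i \<noteq> j" using x y by simp
      then obtain e where e: "e \<subseteq> {1..r}" "card e = 2" "i \<in> e" "j \<notin> e"
        using ex_pair_separating[OF x(2) y(2)] by blast
      then have "(PairVertex e, 0) \<in> pverts (blown s)" by (simp add: blown_vert)
      then have "(x, (PairVertex e, 0)) \<in> parcs (blown s) \<longleftrightarrow> (y, (PairVertex e, 0)) \<in> parcs (blown s)"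
        using same by (simp add: same_neighbours_def)
      then show False using e x y by (simp add: blown_arc)
    qed
  next
    assume "port_index x = port_index y"
    then show "same_neighbours (blown s) x y"
      using x y by (simp add: same_neighbours_def blown_arc)
  qed
qed

text \<open>A second copy is a twin of a port. Conversely, a pair vertex is determined by the ports
  it sees. A selector vertex is adjacent to every other selector vertex; it differs from a port in
  seeing another selector vertex, and from a pair vertex in seeing no port.\<close>

lemma has_twin_iff_port:
  assumes s: "\<And>i. i \<in> {1..r} \<Longrightarrow> s i \<ge> 2" and x: "x \<in> pverts (blown s)"
  shows "has_twin (blown s) x \<longleftrightarrow> is_port x"
proof
  assume port: "is_port x"
  obtain i c where i: "x = (Port i, c)" "i \<in> {1..r}" "c < s i"
    using x port by (cases rule: blown_cases) auto
  define c' where "c' = (if c = 0 then 1 else 0 :: nat)"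
  have "c' < s i" "c' \<noteq> c" using s[OF i(2)] by (auto simp: c'_def)
  then have "(Port i, c') \<in> pverts (blown s)" "(Port i, c') \<noteq> x"
      "same_neighbours (blown s) x (Port i, c')"
    using i by (auto simp: blown_vert same_neighbours_def blown_arc)
  then show "has_twin (blown s) x" unfolding has_twin_def by blast
next
  assume "has_twin (blown s) x"
  then obtain y where y: "y \<in> pverts (blown s)" "y \<noteq> x"
    and same: "\<And>w. w \<in> pverts (blown s) \<Longrightarrow> (x, w) \<in> parcs (blown s) \<longleftrightarrow> (y, w) \<in> parcs (blown s)"
    unfolding has_twin_def same_neighbours_def by blast
  have port: "(Port i, 0) \<in> pverts (blown s)" "0 < s i" if "i \<in> {1..r}" for i
    using s[OF that] that by (simp_all add: blown_vert del: atLeastAtMost_iff)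
  have adj: "(x, (Port i, 0)) \<in> parcs (blown s) \<longleftrightarrow> (y, (Port i, 0)) \<in> parcs (blown s)"
    if "i \<in> {1..r}" for i
    using same[OF port(1)[OF that]] .
  show "is_port x"
    using x
  proof (cases rule: blown_cases)
    case (pair e)
    then obtain i where i: "i \<in> e" by (auto simp: card_2_iff)
    then have ir: "i \<in> {1..r}" using pair by blast
    then have yi: "(y, (Port i, 0)) \<in> parcs (blown s)"
      using adj[OF ir] pair i port by (simp add: blown_arc del: atLeastAtMost_iff)
    obtain e' where e': "y = (PairVertex e', 0)" "e' \<subseteq> {1..r}" "card e' = 2"
      using y(1) yi by (cases rule: blown_cases) (auto simp: blown_arc)
    have "k \<in> e \<longleftrightarrow> k \<in> e'" if "k \<in> {1..r}" for k
      using adj[OF that] port(2)[OF that] pair e' by (simp add: blown_arc)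
    then have "e = e'" using pair e' by blast
    then show ?thesis using y pair e' by simp
  next
    case (sel F)
    show ?thesis
      using y(1)
    proof (cases rule: blown_cases)
      case (port j c)
      have "\<not> \<F> \<subseteq> {F}"
        using card_mono[of "{F}" \<F>] card_seed_family_ge_2 by auto
      then obtain F' where F': "F' \<in> \<F>" "F' \<noteq> F" by blast
      then have "(SelVertex F', 0) \<in> pverts (blown s)" by (simp add: blown_vert)
      then show ?thesis
        using same sel port F' by (fastforce simp: blown_arc)
    next
      case (pair e)
      then obtain i where i: "i \<in> e" by (auto simp: card_2_iff)
      then have ir: "i \<in> {1..r}" using pair by blast
      then show ?thesis
        using adj[OF ir] port[OF ir] sel pair i by (simp add: blown_arc)
    next
      case (sel F')
      then show ?thesis
        using same[OF y(1)] y(2) \<open>x = (SelVertex F, 0)\<close> \<open>F \<in> \<F>\<close> by (simp add: blown_arc)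
    qed
  qed simp
qed

lemma seed_graph_in_family: "X \<in> \<F>"
  unfolding seed_family_def mem_Collect_eq
  by (intro exI[of _ id] conjI perm_graph_id[symmetric] permutes_id) simp

lemma stabilizing_perm_even:
  assumes "\<pi> permutes {1..r}" "perm_graph \<pi> X \<in> \<F>"
  shows "evenperm \<pi>"
proof (rule ccontr)
  assume odd: "\<not> evenperm \<pi>"
  obtain \<sigma> where "perm_graph \<pi> X = perm_graph \<sigma> X" "\<sigma> permutes {1..r}" "evenperm \<sigma>"
    using assms(2) unfolding seed_family_def by blast
  then show False using odd_image_neq[OF _ _ assms(1) odd] by blast
qed

text \<open>Ports are exactly the vertices with a twin, pair vertices are the other vertices adjacent to a
  port, and selector vertices are the rest; hence an isomorphism preserves all three kinds and is
  determined, up to twins, by a permutation of the port classes.\<close>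

lemma blown_isoD:
  assumes iso: "digraph_iso (blown s) (blown s')"
    and s: "\<And>i. i \<in> {1..r} \<Longrightarrow> s i \<ge> 2" and s': "\<And>i. i \<in> {1..r} \<Longrightarrow> s' i \<ge> 2"
  shows "\<exists>\<pi>. \<pi> permutes {1..r} \<and> evenperm \<pi> \<and> (\<forall>i\<in>{1..r}. s' (\<pi> i) = s i)"
proof -
  let ?V = "pverts (blown s)" and ?V' = "pverts (blown s')"
  obtain h where bij: "bij_betw h ?V ?V'"
    and arc: "\<And>u v. u \<in> ?V \<Longrightarrow> v \<in> ?V \<Longrightarrow> (u, v) \<in> parcs (blown s) \<longleftrightarrow> (h u, h v) \<in> parcs (blown s')"
    using digraph_isoE[OF iso] by blast
  have hV: "h x \<in> ?V'" if "x \<in> ?V" for x using bij that by (auto simp: bij_betw_def)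
  have is_port: "is_port (h x) \<longleftrightarrow> is_port x" if "x \<in> ?V" for x
    using has_twin_iso[OF bij arc that] has_twin_iff_port[OF s that] has_twin_iff_port[OF s' hV[OF that]]
    by blast
  have index: "port_index (h x) = port_index (h y) \<longleftrightarrow> port_index x = port_index y"
    if xy: "x \<in> ?V" "y \<in> ?V" "is_port x" "is_port y" for x y
  proof -
    have one: "s i \<ge> 1" "s' i \<ge> 1" if "i \<in> {1..r}" for i using s[OF that] s'[OF that] by simp_all
    have "same_neighbours (blown s) x y \<longleftrightarrow> port_index x = port_index y"
      by (rule same_neighbours_port[OF one(1) xy])
    moreover have "same_neighbours (blown s') (h x) (h y) \<longleftrightarrow> port_index (h x) = port_index (h y)"
      by (rule same_neighbours_port[OF one(2)]) (use xy hV is_port in auto)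
    ultimately show ?thesis using same_neighbours_iso[OF bij arc xy(1,2)] by blast
  qed
  have P: "(Port i, c) \<in> ?V" if "i \<in> {1..r}" "c < s i" for i c
    using that by (simp add: blown_vert)
  have pos: "0 < s i" if "i \<in> {1..r}" for i using s[OF that] by simp
  \<comment> \<open>Copy 0 represents its class; by \<open>index\<close> every other copy gives the
    same value.\<close>
  define \<pi> where "\<pi> i = (if i \<in> {1..r} then port_index (h (Port i, 0)) else i)" for i
  have h_port: "\<exists>c'<s' (\<pi> i). h (Port i, c) = (Port (\<pi> i), c')" and \<pi>: "\<pi> i \<in> {1..r}"
    if i: "i \<in> {1..r}" "c < s i" for i c
  proof -
    have idx: "port_index (h (Port i, c)) = \<pi> i"
      using index[OF P[OF i] P[OF i(1) pos[OF i(1)]]] i(1) by (simp add: \<pi>_def)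
    have port: "is_port (h (Port i, c))" using is_port[OF P[OF i]] by simp
    have "\<pi> i \<in> {1..r} \<and> (\<exists>c'<s' (\<pi> i). h (Port i, c) = (Port (\<pi> i), c'))"
      using hV[OF P[OF i]] idx port by (cases rule: blown_cases) auto
    then show "\<exists>c'<s' (\<pi> i). h (Port i, c) = (Port (\<pi> i), c')" "\<pi> i \<in> {1..r}" by blast+
  qed
  have inj: "inj_on \<pi> {1..r}"
  proof (rule inj_onI)
    fix i j assume ij: "i \<in> {1..r}" "j \<in> {1..r}" "\<pi> i = \<pi> j"
    then have "port_index (h (Port i, 0)) = port_index (h (Port j, 0))" by (simp add: \<pi>_def)
    then show "i = j" using index[of "(Port i, 0)" "(Port j, 0)"] P pos ij by simp
  qed
  have perm: "\<pi> permutes {1..r}"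
  proof (rule bij_imp_permutes)
    have "\<pi> ` {1..r} \<subseteq> {1..r}" using \<pi> pos by blast
    then show "bij_betw \<pi> {1..r} {1..r}" using inj by (simp add: bij_betw_def endo_inj_surj)
    show "\<pi> i = i" if "i \<notin> {1..r}" for i
      by (simp only: \<pi>_def that if_False)
  qed
  have mult: "s' (\<pi> i) = s i" if i: "i \<in> {1..r}" for i
  proof -
    let ?A = "(\<lambda>c. (Port i, c)) ` {..<s i}" and ?B = "(\<lambda>c. (Port (\<pi> i), c)) ` {..<s' (\<pi> i)}"
    \<comment> \<open>An isomorphism maps each port class onto a whole port class, so the class
      sizes agree.\<close>
    have "h ` ?A = ?B"
    proof (intro set_eqI iffI)
      fix y assume "y \<in> h ` ?A"
      then show "y \<in> ?B" using h_port[OF i] by auto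
    next
      fix y assume "y \<in> ?B"
      then obtain c' where y: "y = (Port (\<pi> i), c')" "c' < s' (\<pi> i)" by blast
      then have "y \<in> ?V'" using \<pi>[OF i pos[OF i]] by (simp add: blown_vert)
      then obtain x where x: "x \<in> ?V" "y = h x"
        unfolding bij_betw_imp_surj_on[OF bij, symmetric] by blast
      have "is_port (h x)" unfolding x(2)[symmetric] y(1) by simp
      then have px: "is_port x" using is_port[OF x(1)] by blast
      obtain j c where j: "x = (Port j, c)" "j \<in> {1..r}" "c < s j"
        using x(1) px by (cases rule: blown_cases) auto
      have "\<pi> j = \<pi> i" using h_port[OF j(2,3)] j(1) x(2) y(1) by auto
      then have "j = i" using inj j(2) i by (auto dest: inj_onD)
      then show "y \<in> h ` ?A" using j x by blast
    qed
    moreover have "inj_on h ?A"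
      by (rule inj_on_subset[OF bij_betw_imp_inj_on[OF bij]]) (use P i in auto)
    ultimately have "card ?B = card ?A" using card_image by metis
    then show ?thesis by (simp add: card_image inj_on_def)
  qed
  \<comment> \<open>The copy number of the image is unknown, but copies are twins, so one adjacent
    copy suffices.\<close>
  have port_arc: "(u, (Port k, 0)) \<in> parcs (blown s) \<longleftrightarrow>
      (\<exists>c'<s' (\<pi> k). (h u, (Port (\<pi> k), c')) \<in> parcs (blown s'))"
    if "u \<in> ?V" "k \<in> {1..r}" for u k
    using arc[OF that(1) P[OF that(2) pos[OF that(2)]]] h_port[OF that(2) pos[OF that(2)]]
    by (auto simp: blown_arc)
  have h_pair: "h (PairVertex e, 0) = (PairVertex (\<pi> ` e), 0)" if e: "e \<subseteq> {1..r}" "card e = 2" for e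
  proof -
    let ?u = "(PairVertex e, 0)"
    have u: "?u \<in> ?V" using e by (simp add: blown_vert)
    obtain i where i: "i \<in> e" using e by (auto simp: card_2_iff)
    then have ir: "i \<in> {1..r}" using e by blast
    have "(?u, (Port i, 0)) \<in> parcs (blown s)" using e i pos[OF ir] by (simp add: blown_arc)
    then obtain c' where c': "(h ?u, (Port (\<pi> i), c')) \<in> parcs (blown s')"
      using port_arc[OF u ir] by blast
    obtain e' where e': "h ?u = (PairVertex e', 0)" "e' \<subseteq> {1..r}" "card e' = 2"
      using hV[OF u] c' by (cases rule: blown_cases) (auto simp: blown_arc)
    have mem: "\<pi> k \<in> e' \<longleftrightarrow> k \<in> e" if k: "k \<in> {1..r}" for k
      using port_arc[OF u k] e e' pos[OF k] mult[OF k] by (auto simp: blown_arc)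
    have "e' = \<pi> ` e"
    proof (intro set_eqI iffI)
      fix y assume y: "y \<in> e'"
      then have "y \<in> \<pi> ` {1..r}" using e'(2) permutes_image[OF perm] by auto
      then show "y \<in> \<pi> ` e" using mem y by blast
    next
      fix y assume "y \<in> \<pi> ` e"
      then show "y \<in> e'" using mem e(1) by blast
    qed
    then show ?thesis using e' by simp
  qed
  \<comment> \<open>One selector vertex, that of the seed, suffices to read off the parity of
    \<open>\<pi>\<close>.\<close>
  have "\<exists>F' \<in> \<F>. h (SelVertex X, 0) = (SelVertex F', 0)"
  proof -
    let ?u = "(SelVertex X, 0)"
    have u: "?u \<in> ?V" using seed_graph_in_family by (simp add: blown_vert)
    show ?thesis
      using hV[OF u]
    proof (cases rule: blown_cases)
      case (port i c)
      then show ?thesis using is_port[OF u] by simp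
    next
      case (pair e')
      then obtain y where y: "y \<in> e'" by (auto simp: card_2_iff)
      then have "y \<in> \<pi> ` {1..r}" using pair permutes_image[OF perm] by auto
      then obtain k where k: "k \<in> {1..r}" "y = \<pi> k" by blast
      then have "(h ?u, (Port (\<pi> k), 0)) \<in> parcs (blown s')" "0 < s' (\<pi> k)"
        using pair y mult[OF k(1)] pos[OF k(1)] by (simp_all add: blown_arc)
      then have "(?u, (Port k, 0)) \<in> parcs (blown s)"
        using port_arc[OF u k(1)] by blast
      then show ?thesis by (simp add: blown_arc)
    next
      case (sel F)
      then show ?thesis by blast
    qed
  qed
  then obtain F' where F': "F' \<in> \<F>" "h (SelVertex X, 0) = (SelVertex F', 0)" by blast
  \<comment> \<open>The pair vertices adjacent to a selector vertex spell out the edges of its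
    graph, and \<open>h\<close> moves pair vertices by \<open>\<pi>\<close>.\<close>
  have "perm_graph \<pi> X = F'"
  proof (rule eq_if_same_edges[where V = "{1..r}"])
    show "pair_graph (perm_graph \<pi> X)"
      by (intro pair_graph_perm_graph pair_graph_seed_graph labeling permutes_inj[OF perm])
    show "pverts (perm_graph \<pi> X) = {1..r}"
      using permutes_image[OF perm] by (simp add: perm_graph_def seed_graph_def)
    show "pair_graph F'" "pverts F' = {1..r}"
      using seed_family_graph[OF labeling F'(1)] .
    fix e assume e: "e \<subseteq> {1..r}" "card e = 2"
    let ?e = "inv \<pi> ` e"
    have e': "?e \<subseteq> {1..r}" "card ?e = 2" "\<pi> ` ?e = e"
      using e image_pair_iff[OF permutes_inv[OF perm]] permutes_inverses[OF perm]
      by (simp_all add: image_image)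
    have "has_edge X ?e \<longleftrightarrow> ((SelVertex X, 0), (PairVertex ?e, 0)) \<in> parcs (blown s)"
      using seed_graph_in_family by (simp add: blown_arc)
    also have "\<dots> \<longleftrightarrow> ((SelVertex F', 0), (PairVertex e, 0)) \<in> parcs (blown s')"
      using arc[of "(SelVertex X, 0)" "(PairVertex ?e, 0)"] h_pair[OF e'(1,2)] e' F'(2) seed_graph_in_family
      by (simp add: blown_vert)
    also have "\<dots> \<longleftrightarrow> has_edge F' e"
      using F' by (simp add: blown_arc)
    finally show "has_edge (perm_graph \<pi> X) e \<longleftrightarrow> has_edge F' e"
      using has_edge_perm_graph[OF permutes_inj[OF perm], of X ?e] e'(3) by simp
  qed
  then have "evenperm \<pi>" using stabilizing_perm_even[OF perm] F' by simp
  then show ?thesis using perm mult by blast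
qed

section \<open>Connectedness and order of the blow-ups\<close>

lemma connected_blown:
  assumes s: "\<And>i. i \<in> {1..r} \<Longrightarrow> s i \<ge> 1"
  shows "Digraph_Component.connected (blown s)"
proof (rule connectedI_hub)
  let ?V = "pverts (blown s)"
  let ?R = "rtrancl_on ?V ((parcs (blown s))\<^sup>s)"
  \<comment> \<open>The hub: ports 1 and 2 touch it, any other port i reaches port 1 through the
    pair \<open>{1, i}\<close>, pair vertices go through one of their ports, and selector vertices
    through an edge of their graph.\<close>
  let ?w = "(PairVertex {1, 2}, 0)"
  have pos: "0 < s i" if "i \<in> {1..r}" for i using s[OF that] by simp
  have r12: "1 \<in> {1..r}" "2 \<in> {1..r}" using r_ge_4 by auto
  have step: "(u, w) \<in> ?R" if "(u, v) \<in> parcs (blown s)" "(v, w) \<in> ?R" for u v w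
  proof (rule converse_rtrancl_on_into_rtrancl_on[OF _ that(2)])
    show "(u, v) \<in> (parcs (blown s))\<^sup>s" using that(1) by (simp add: symcl_iff)
    show "u \<in> ?V" using blown_arc_verts[OF that(1)] by blast
  qed
  have e12: "{1, 2} \<subseteq> {1..r}" "card {1, 2 :: nat} = 2" using r12 by auto
  show w: "?w \<in> ?V" using e12 by (simp add: blown_vert del: atLeastAtMost_iff)
  have ww: "(?w, ?w) \<in> ?R" using w by simp
  have port_pair: "((Port i, c), (PairVertex e, 0)) \<in> parcs (blown s)"
     "((PairVertex e, 0), (Port i, c)) \<in> parcs (blown s)"
    if "i \<in> e" "c < s i" "e \<subseteq> {1..r}" "card e = 2" for i c e
    using that by (simp_all add: blown_arc)
  have hub_port: "((Port i, c), ?w) \<in> ?R" if i: "i \<in> {1..r}" "c < s i" for i c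
  proof (cases "i = 1 \<or> i = 2")
    case True
    then have "i \<in> {1, 2}" by blast
    then show ?thesis by (rule step[OF port_pair(1)[OF _ i(2) e12] ww])
  next
    case False
    have one: "((Port 1, 0), ?w) \<in> ?R"
      by (rule step[OF port_pair(1)[OF insertI1 pos[OF r12(1)] e12] ww])
    have e: "{1, i} \<subseteq> {1..r}" "card {1, i} = 2" using False r12 i by auto
    have "((PairVertex {1, i}, 0), ?w) \<in> ?R"
      by (rule step[OF port_pair(2)[OF insertI1 pos[OF r12(1)] e] one])
    moreover have "i \<in> {1, i}" by simp
    ultimately show ?thesis by (intro step[OF port_pair(1)[OF _ i(2) e]])
  qed
  have hub_pair: "((PairVertex e, 0), ?w) \<in> ?R" if e: "e \<subseteq> {1..r}" "card e = 2" for e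
  proof -
    obtain i where i: "i \<in> e" using e by (auto simp: card_2_iff)
    then have ir: "i \<in> {1..r}" using e by blast
    show ?thesis by (rule step[OF port_pair(2)[OF i pos[OF ir] e] hub_port[OF ir pos[OF ir]]])
  qed
  show "(v, ?w) \<in> ?R" if "v \<in> ?V" for v
    using that
  proof (cases rule: blown_cases)
    case (sel F)
    obtain \<sigma> where \<sigma>: "F = perm_graph \<sigma> X" "\<sigma> permutes {1..r}"
      using sel by (auto simp: seed_family_def)
    have "(a 1, d 1) \<in> parcs X" using seed_arc(2)[of 1 1] r_ge_4 by simp
    then have arc: "(\<sigma> (a 1), \<sigma> (d 1)) \<in> parcs F"
      unfolding \<sigma>(1) by (simp add: perm_graph_arc_iff permutes_inj[OF \<sigma>(2)])
    interpret F: pair_graph F by (rule seed_family_graph(1)[OF labeling sel(2)])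
    let ?e = "{\<sigma> (a 1), \<sigma> (d 1)}"
    have e: "?e \<subseteq> {1..r}" "card ?e = 2"
      using F.in_arcsD1[OF arc] F.in_arcsD2[OF arc] F.no_loops'[OF arc]
        seed_family_graph(2)[OF labeling sel(2)] by simp_all
    have "(v, (PairVertex ?e, 0)) \<in> parcs (blown s)"
      using sel arc F.has_edge_doubleton by (simp add: blown_arc)
    then show ?thesis by (rule step[OF _ hub_pair[OF e]])
  qed (use hub_port hub_pair in simp_all)
qed

lemma card_blown:
  "card (pverts (blown s)) = (\<Sum>i = 1..r. s i) + (r choose 2) + card \<F>"
proof -
  let ?P = "(\<lambda>(i, c). (Port i, c)) ` Sigma {1..r} (\<lambda>i. {..<s i})"
  let ?E = "{e. e \<subseteq> {1..r} \<and> card e = 2}"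
  let ?Q = "(\<lambda>e. (PairVertex e, 0 :: nat)) ` ?E" and ?Z = "(\<lambda>F. (SelVertex F, 0 :: nat)) ` \<F>"
  have V: "pverts (blown s) = ?P \<union> ?Q \<union> ?Z"
  proof (intro set_eqI iffI)
    fix x assume "x \<in> pverts (blown s)"
    then show "x \<in> ?P \<union> ?Q \<union> ?Z" by (cases rule: blown_cases) force+
  next
    fix x assume "x \<in> ?P \<union> ?Q \<union> ?Z"
    then show "x \<in> pverts (blown s)" by (auto simp: blown_vert)
  qed
  have finE: "finite ?E" by (rule finite_subset[of _ "Pow {1..r}"]) auto
  have "card ?P = (\<Sum>i = 1..r. s i)"
    by (subst card_image) (auto simp: inj_on_def)
  moreover have "card ?Q = r choose 2"
    using n_subsets[of "{1..r}" 2] by (subst card_image) (auto simp: inj_on_def)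
  moreover have "card ?Z = card \<F>"
    by (rule card_image) (auto simp: inj_on_def)
  moreover have "card (?P \<union> ?Q \<union> ?Z) = card ?P + card ?Q + card ?Z"
    using finE finite_seed_family by (subst card_Un_disjoint; (subst card_Un_disjoint)?) auto
  ultimately show ?thesis unfolding V by simp
qed

end

section \<open>The two multiplicity vectors\<close>

lemma b_vec_transpose: "b_vec t (transpose 1 2 i) = a_vec t i"
  by (auto simp: b_vec_def a_vec_def transpose_def)

lemma sum_a_vec: "real (\<Sum>i = 1..r. a_vec t i) = real r * real t + real r * (real r + 1) / 2"
proof (induction r)
  case (Suc r)
  have "(\<Sum>i = 1..Suc r. a_vec t i) = (\<Sum>i = 1..r. a_vec t i) + a_vec t (Suc r)" by simp
  then have "real (\<Sum>i = 1..Suc r. a_vec t i) = real (\<Sum>i = 1..r. a_vec t i) + real (a_vec t (Suc r))"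
    by (simp only: of_nat_add)
  then show ?case unfolding Suc.IH by (simp add: a_vec_def field_simps)
qed simp

lemma sum_b_vec:
  assumes "r \<ge> 2"
  shows "(\<Sum>i = 1..r. b_vec t i) = (\<Sum>i = 1..r. a_vec t i)"
proof -
  have "transpose 1 2 permutes {1..r}" using assms by (intro permutes_swap_id) auto
  then have "(\<Sum>i = 1..r. b_vec t i) = (\<Sum>i = 1..r. (b_vec t \<circ> transpose 1 2) i)"
    by (rule sum.permute)
  then show ?thesis by (simp only: comp_apply b_vec_transpose)
qed

context seed begin

lemma real_card_seed_family: "real (card \<F>) = fact r / (2 * fact (r div 2))"
proof -
  have "2 * (real (card \<F>) * fact (r div 2)) = fact r"
    using arg_cong[OF card_seed_family, of real] by (simp only: of_nat_mult of_nat_numeral of_nat_fact)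
  then show ?thesis by (simp add: field_simps)
qed

lemma tr12: "transpose 1 2 permutes {1..r}"
  using r_ge_4 by (intro permutes_swap_id) auto

lemma not_iso_swapped:
  assumes "t \<ge> 1"
  shows "\<not> digraph_iso (blown (a_vec t)) (blown (b_vec t))"
proof
  assume "digraph_iso (blown (a_vec t)) (blown (b_vec t))"
  \<comment> \<open>The smallest entry is t + 1; for t >= 1 every port therefore has a twin.\<close>
  moreover have "a_vec t i \<ge> 2" "b_vec t i \<ge> 2" if "i \<in> {1..r}" for i
    using that assms by (auto simp: a_vec_def b_vec_def)
  ultimately obtain \<pi> where \<pi>: "\<pi> permutes {1..r}" "evenperm \<pi>"
    and eq: "\<And>i. i \<in> {1..r} \<Longrightarrow> b_vec t (\<pi> i) = a_vec t i"
    using blown_isoD by blast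
  \<comment> \<open>Distinct multiplicities leave \<open>\<pi>\<close> no choice.\<close>
  have inj: "x = y" if "b_vec t x = b_vec t y" "x \<ge> 1" "y \<ge> 1" for x y
    using that by (auto simp: b_vec_def a_vec_def split: if_splits)
  have "\<pi> i = transpose 1 2 i" for i
  proof (cases "i \<in> {1..r}")
    case True
    then have "\<pi> i \<in> {1..r}" "transpose 1 2 i \<in> {1..r}"
      using permutes_in_image[OF \<pi>(1)] permutes_in_image[OF tr12] by blast+
    then show ?thesis
      using eq[OF True] by (intro inj[of "\<pi> i" "transpose 1 2 i"]) (simp_all add: b_vec_transpose)
  next
    case False
    then show ?thesis using \<pi>(1) tr12 by (metis permutes_not_in)
  qed
  then have "\<pi> = transpose 1 2" by blast
  then show False using \<pi>(2) by (simp add: evenperm_swap)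
qed

text \<open>Deleting a copy of port \<open>i \<ge> 2\<close> leaves ports \<open>i - 1\<close> and \<open>i\<close> with equally many copies, so the odd
  swap of ports 1 and 2 can be corrected to an even permutation by swapping \<open>i - 1\<close> and \<open>i\<close>.\<close>

lemma common_cards_ge: "L_bound r t \<le> real (common_cards (blown (a_vec t)) (blown (b_vec t)))"
proof -
  let ?\<tau> = "transpose 1 2 :: nat \<Rightarrow> nat" and ?G = "blown (a_vec t)" and ?H = "blown (b_vec t)"
  \<comment> \<open>Indices start at 2: port 1 has no predecessor with which to become equally
    large.\<close>
  define W where "W = (\<lambda>(i, c). (Port i, c)) ` Sigma {2..r} (\<lambda>i. {..<a_vec t i})"
  define g where "g = map_prod (relabel ?\<tau> id) (id :: nat \<Rightarrow> nat)"
  have bij: "bij_betw g (pverts ?G) (pverts ?H)"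
    unfolding g_def by (rule bij_betw_blown[OF tr12 bij_betw_id]) (rule b_vec_transpose)
  have W: "W \<subseteq> pverts ?G"
    unfolding W_def by (auto simp: blown_vert)
  have "card W \<le> common_cards ?G ?H"
  proof (rule card_le_common_cards[OF pair_graph_blown pair_graph_blown W])
    show "g ` W \<subseteq> pverts ?H" using W bij by (auto simp: bij_betw_def)
    show "inj_on g W" using W bij by (auto simp: bij_betw_def intro: inj_on_subset)
    fix v assume "v \<in> W"
    then obtain i c where v: "v = (Port i, c)" "i \<ge> 2" "i \<le> r" "c < a_vec t i"
      unfolding W_def by auto
    let ?\<kappa> = "transpose (i - 1) i"
    have \<kappa>: "?\<kappa> permutes {1..r}" using v by (intro permutes_swap_id) auto
    have i: "i \<in> {1..r}" using v by simp
    \<comment> \<open>For i = 2 both transpositions coincide and the product is the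
      identity.\<close>
    have even: "evenperm (?\<tau> \<circ> ?\<kappa>)"
      using v(2) by (simp add: evenperm_comp permutation_swap_id evenperm_swap)
    have perm: "?\<tau> \<circ> ?\<kappa> permutes {1..r}" by (rule permutes_compose[OF \<kappa> tr12])
    have mem: "?\<tau> i \<in> {1..r}" using permutes_in_image[OF tr12] i by blast
    \<comment> \<open>After \<open>b_vec_transpose\<close> only \<open>?\<kappa>\<close> matters: t
      + i - 1 copies remain of port i, as many as port i - 1 has.\<close>
    have mult: "b_vec t ((?\<tau> \<circ> ?\<kappa>) k) - of_bool ((?\<tau> \<circ> ?\<kappa>) k = ?\<tau> i) = a_vec t k - of_bool (k = i)" for k
    proof -
      have "(?\<tau> \<circ> ?\<kappa>) k = ?\<tau> i \<longleftrightarrow> ?\<kappa> k = i"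
        using permutes_inj[OF tr12] by (simp add: inj_eq)
      then show ?thesis
        using v(2) unfolding comp_apply b_vec_transpose
        by (auto simp: a_vec_def transpose_def)
    qed
    have "c < b_vec t (?\<tau> i)" using v(4) by (simp only: b_vec_transpose)
    then have "digraph_iso (pre_digraph.del_vert ?G (Port i, c)) (pre_digraph.del_vert ?H (Port (?\<tau> i), c))"
      by (rule blown_del_vert_iso[OF perm even i, of c "a_vec t", OF v(4) mem]) (rule mult)
    then show "digraph_iso (pre_digraph.del_vert ?G v) (pre_digraph.del_vert ?H (g v))"
      by (simp add: v(1) g_def)
  qed
  moreover have "real (card W) = L_bound r t"
  proof -
    have "card W = (\<Sum>i = 2..r. a_vec t i)"
      unfolding W_def by (subst card_image) (auto simp: inj_on_def)
    moreover have "(\<Sum>i = 1..r. a_vec t i) = a_vec t 1 + (\<Sum>i = 2..r. a_vec t i)"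
      using r_ge_4 sum.atLeast_Suc_atMost[of 1 r "a_vec t"] by (simp add: numeral_2_eq_2 One_nat_def)
    \<comment> \<open>Subtracting the t + 1 copies of port 1 produces the coefficient r - 1 and the
      final -1 of \<open>L_bound\<close>.\<close>
    ultimately have "real (card W) = real (\<Sum>i = 1..r. a_vec t i) - real (a_vec t 1)"
      by simp
    then show ?thesis
      unfolding sum_a_vec by (simp add: L_bound_def a_vec_def algebra_simps)
  qed
  ultimately show ?thesis by simp
qed

end

section \<open>Asymptotics of the ratio\<close>

lemma L_bound_over_n_order_tendsto:
  assumes "r > 0"
  shows "(\<lambda>t. L_bound r t / n_order r t) \<longlonglongrightarrow> 1 - 1 / real r"
proof -
  \<comment> \<open>The constant terms of numerator and denominator, which are linear in t with
    slopes r - 1 and r.\<close>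
  define p q where "p = real r * (real r + 1) / 2 - 1" and "q = real r * (real r + 1) / 2 + C_const r"
  have "(\<lambda>t. ((real r - 1) + p / real t) / (real r + q / real t)) \<longlonglongrightarrow> ((real r - 1) + 0) / (real r + 0)"
    using assms by (intro tendsto_intros lim_const_over_n) simp
  moreover have "\<forall>\<^sub>F t in sequentially.
      ((real r - 1) + p / real t) / (real r + q / real t) = L_bound r t / n_order r t"
    using eventually_gt_at_top[of 0]
  proof eventually_elim
    case (elim t)
    have "(real r - 1) + p / real t = L_bound r t / real t" "real r + q / real t = n_order r t / real t"
      using elim by (simp_all add: L_bound_def n_order_def p_def q_def field_simps)
    then show ?case using elim by simp
  qed
  ultimately have "(\<lambda>t. L_bound r t / n_order r t) \<longlonglongrightarrow> ((real r - 1) + 0) / (real r + 0)"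
    by (rule Lim_transform_eventually)
  moreover have "((real r - 1) + 0) / (real r + 0) = 1 - 1 / real r"
    using assms by (simp add: field_simps)
  ultimately show ?thesis by simp
qed

lemma liminf_ratio_ge:
  assumes "r > 0" and "\<And>t. t \<ge> 1 \<Longrightarrow> L_bound r t \<le> f t"
  shows "liminf (\<lambda>t. ereal (f t / n_order r t)) \<ge> ereal (1 - 1 / real r)"
proof -
  have "(\<lambda>t. ereal (L_bound r t / n_order r t)) \<longlonglongrightarrow> ereal (1 - 1 / real r)"
    by (intro tendsto_ereal L_bound_over_n_order_tendsto assms(1))
  then have "ereal (1 - 1 / real r) = liminf (\<lambda>t. ereal (L_bound r t / n_order r t))"
    by (intro lim_imp_Liminf[symmetric]) simp_all
  also have "\<dots> \<le> liminf (\<lambda>t. ereal (f t / n_order r t))"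
  proof (rule Liminf_mono)
    show "\<forall>\<^sub>F t in sequentially. ereal (L_bound r t / n_order r t) \<le> ereal (f t / n_order r t)"
      using eventually_ge_at_top[of 1]
    proof eventually_elim
      case (elim t)
      \<comment> \<open>A nonnegative denominator makes division monotone in the numerator.\<close>
      have "n_order r t \<ge> 0" by (simp add: n_order_def C_const_def)
      then show ?case using assms(2)[OF elim] by (simp add: divide_right_mono)
    qed
  qed
  finally show ?thesis .
qed

theorem theorem3p3:
  fixes r :: nat and a d :: "nat \<Rightarrow> nat"
  assumes "even r" and "r \<ge> 4"
    and "seed_labeling r a d"
  shows "(\<forall>t\<ge>1.
            Digraph_Component.connected (G_graph a d r t) \<and>
            Digraph_Component.connected (H_graph a d r t) \<and>
            \<not> digraph_iso (G_graph a d r t) (H_graph a d r t) \<and>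
            degree_multiset (G_graph a d r t) = degree_multiset (H_graph a d r t) \<and>
            real (card (verts (G_graph a d r t))) = n_order r t \<and>
            real (card (verts (H_graph a d r t))) = n_order r t \<and>
            real (common_cards (G_graph a d r t) (H_graph a d r t)) \<ge> L_bound r t) \<and>
         liminf (\<lambda>t. ereal (real (common_cards (G_graph a d r t) (H_graph a d r t)) / n_order r t))
           \<ge> ereal (1 - 1 / real r)"
proof -
  interpret seed r a d using assms by unfold_locales
  have order: "real (card (pverts (blown (a_vec t)))) = n_order r t"
      "real (card (pverts (blown (b_vec t)))) = n_order r t" for t
    unfolding card_blown of_nat_add sum_b_vec[OF order_trans[OF _ assms(2), of 2, simplified]]
      sum_a_vec real_card_seed_family n_order_def C_const_def by simp_all
  have pos: "a_vec t i \<ge> 1" "b_vec t i \<ge> 1" if "i \<in> {1..r}" for t i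
    using that by (auto simp: a_vec_def b_vec_def)
  have conn: "Digraph_Component.connected (blown (a_vec t))" "Digraph_Component.connected (blown (b_vec t))" for t
    using pos by (auto intro!: connected_blown)
  have deg: "degree_multiset (blown (a_vec t)) = degree_multiset (blown (b_vec t))" for t
    by (rule degree_multiset_blown[OF tr12]) (rule b_vec_transpose)
  have "liminf (\<lambda>t. ereal (real (common_cards (blown (a_vec t)) (blown (b_vec t))) / n_order r t))
      \<ge> ereal (1 - 1 / real r)"
    using assms(2) common_cards_ge by (intro liminf_ratio_ge) auto
  then show ?thesis
    unfolding G_graph_def H_graph_def with_proj_simps
    using order conn deg not_iso_swapped common_cards_ge by blast
qed

end
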